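(* There is a function $f$ such that for every policy $K$ with finite $C(K)$ and every policy $K'$ with $$\|K'-K\|\le\min\left(\frac{\Lambda_{\min}(Q)\,\mu}{4\,C(K)\sum_{i=1}^{N_s}\|B_i\|\,(\|A_i-B_iK_i\|+1)},\ \sum_{i=1}^{N_s}\|K_i\|\right)$$ one has $$|C(K')-C(K)|\le c_{diff}\,\|K-K'\|,\qquad\text{where } c_{diff}=f\left(\|A\|,\|B\|,\|Q\|,\|R\|,\|K\|,\frac{C(K)}{\Lambda_{\min}(Q)}\right).$$
   Context: Setting (a fixed Markovian jump linear system). Let $\Omega=\{1,\dots,N_s\}$ and let $\omega(t)$, $t\ge0$, be a time-homogeneous Markov chain on $\Omega$ with transition probabilities $p_{ij}=\mathbb P(\omega(t+1)=j\mid\omega(t)=i)$ and initial distribution $\pi$. The state $x_t\in\mathbb R^d$ and control $u_t\in\mathbb R^k$ satisfy $x_{t+1}=A_{\omega(t)}x_t+B_{\omega(t)}u_t$, with $A_i\in\mathbb R^{d\times d}$, $B_i\in\mathbb R^{d\times k}$ and $x_0\sim D$ independent of the chain. A policy is a tuple $K=(K_1,\dots,K_{N_s})$, $K_i\in\mathbb R^{k\times d}$, acting by $u_t=-K_{\omega(t)}x_t$; its cost is $C(K)=\mathbb E_{x_0\sim D,\,\omega(0)\sim\pi}\big[\sum_{t=0}^\infty x_t^\top Q_{\omega(t)}x_t+u_t^\top R_{\omega(t)}u_t\big]$. Standing assumptions: all $Q_i\succ0$, all $R_i\succ0$, all $\pi_i>0$, $\mathbb E_{x_0\sim D}[x_0x_0^\top]\succ0$,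 and the system can be mean-square stabilized. Notation: $\|\cdot\|$ on matrices is the maximal singular value; for a tuple $V=(V_1,\dots,V_{N_s})$, $\|V\|=\max_i\|V_i\|$ (the norm of the block-diagonal matrix with blocks $V_i$) and $\Lambda_{\min}(V)=\min_i\sigma_{\min}(V_i)$; $A=(A_i)$, $B=(B_i)$, $Q=(Q_i)$, $R=(R_i)$; and $\mu=\min_i\pi_i\cdot\sigma_{\min}(\mathbb E_{x_0\sim D}[x_0x_0^\top])$. *)

theory Defs
  imports "HOL-Probability.Probability"
begin

definition pos_def :: "real^'n^'n \<Rightarrow> bool" where
  "pos_def A \<longleftrightarrow> transpose A = A \<and> (\<forall>x. x \<noteq> 0 \<longrightarrow> x \<bullet> (A *v x) > 0)"

text \<open>
  Square roots of the eigenvalues of \<open>A\<^sup>T A\<close>. For a matrix with more columns than rows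
  this set also contains 0, which does not affect the maximum; the minimum is only used for
  square matrices.
\<close>
definition singular_values :: "real^'n^'m \<Rightarrow> real set" where
  "singular_values A =
     {s. 0 \<le> s \<and> (\<exists>v. v \<noteq> 0 \<and> (transpose A ** A) *v v = s\<^sup>2 *\<^sub>R v)}"

definition mat_norm :: "real^'n^'m \<Rightarrow> real" where
  "mat_norm A = Max (singular_values A)"

definition sigma_min :: "real^'n^'n \<Rightarrow> real" where
  "sigma_min A = Min (singular_values A)"

text \<open>Tuples of matrices are functions on the finite type of modes.\<close>

definition tuple_norm :: "('s::finite \<Rightarrow> real^'n^'m) \<Rightarrow> real" where
  "tuple_norm V = Max (range (\<lambda>i. mat_norm (V i)))"

definition Lambda_min :: "('s::finite \<Rightarrow> real^'n^'n) \<Rightarrow> real" where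
  "Lambda_min V = Min (range (\<lambda>i. sigma_min (V i)))"

definition outer :: "real^'n \<Rightarrow> real^'n^'n" where
  "outer x = (\<chi> i j. x $ i * x $ j)"

definition second_moment :: "(real^'n) measure \<Rightarrow> real^'n^'n" where
  "second_moment D = (\<integral>x. outer x \<partial>D)"

text \<open>The rows of \<open>p\<close> belonging to modes that are never visited are left unconstrained;
  there are none when \<open>\<pi>\<close> is positive everywhere.\<close>
definition markov_chain ::
  "'m measure \<Rightarrow> (nat \<Rightarrow> 'm \<Rightarrow> 's::finite) \<Rightarrow> ('s \<Rightarrow> real) \<Rightarrow> ('s \<Rightarrow> 's \<Rightarrow> real) \<Rightarrow> bool" where
  "markov_chain M w \<pi> p \<longleftrightarrow>
     (\<forall>t. w t \<in> measurable M (count_space UNIV)) \<and>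
     (\<forall>i. \<P>(m in M. w 0 m = i) = \<pi> i) \<and>
     (\<forall>t h j. \<P>(m in M. \<forall>s\<le>t. w s m = h s) > 0 \<longrightarrow>
        \<P>(m in M. w (Suc t) m = j \<bar> \<forall>s\<le>t. w s m = h s) = p (h t) j)"

definition control :: "('s \<Rightarrow> real^'d^'k) \<Rightarrow> 's \<Rightarrow> real^'d \<Rightarrow> real^'k" where
  "control K i x = - (K i *v x)"

primrec state ::
  "('s \<Rightarrow> real^'d^'d) \<Rightarrow> ('s \<Rightarrow> real^'k^'d) \<Rightarrow> ('s \<Rightarrow> real^'d^'k) \<Rightarrow>
   (nat \<Rightarrow> 's) \<Rightarrow> real^'d \<Rightarrow> nat \<Rightarrow> real^'d" where
  "state A B K \<omega> x 0 = x"
| "state A B K \<omega> x (Suc t) =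
     A (\<omega> t) *v state A B K \<omega> x t + B (\<omega> t) *v control K (\<omega> t) (state A B K \<omega> x t)"

definition stage_cost ::
  "('s \<Rightarrow> real^'d^'d) \<Rightarrow> ('s \<Rightarrow> real^'k^'k) \<Rightarrow> ('s \<Rightarrow> real^'d^'k) \<Rightarrow> 's \<Rightarrow> real^'d \<Rightarrow> real" where
  "stage_cost Q R K i x =
     x \<bullet> (Q i *v x) + control K i x \<bullet> (R i *v control K i x)"

text \<open>The coercion \<open>ennreal\<close> truncates negative reals, so this is the intended
  (possibly infinite) cost only for positive semidefinite \<open>Q i\<close> and \<open>R i\<close>.\<close>
definition cost ::
  "'m measure \<Rightarrow> (nat \<Rightarrow> 'm \<Rightarrow> 's) \<Rightarrow> ('m \<Rightarrow> real^'d) \<Rightarrow>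
   ('s \<Rightarrow> real^'d^'d) \<Rightarrow> ('s \<Rightarrow> real^'k^'d) \<Rightarrow> ('s \<Rightarrow> real^'d^'d) \<Rightarrow> ('s \<Rightarrow> real^'k^'k) \<Rightarrow>
   ('s \<Rightarrow> real^'d^'k) \<Rightarrow> ennreal" where
  "cost M w x0 A B Q R K =
     (\<integral>\<^sup>+ m. (\<Sum>t. ennreal (stage_cost Q R K (w t m) (state A B K (\<lambda>s. w s m) (x0 m) t))) \<partial>M)"

text \<open>Mean-square stability for every deterministic initial state \<open>v\<close> and every initial
  mode \<open>i\<close>; \<open>uniform_measure\<close> conditions the chain on starting in \<open>i\<close>.\<close>
definition ms_stabilizing ::
  "'m measure \<Rightarrow> (nat \<Rightarrow> 'm \<Rightarrow> 's) \<Rightarrow>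
   ('s \<Rightarrow> real^'d^'d) \<Rightarrow> ('s \<Rightarrow> real^'k^'d) \<Rightarrow> ('s \<Rightarrow> real^'d^'k) \<Rightarrow> bool" where
  "ms_stabilizing M w A B K \<longleftrightarrow>
     (\<forall>v i. (\<lambda>t. \<integral>m. (norm (state A B K (\<lambda>s. w s m) v t))\<^sup>2
                 \<partial>uniform_measure M {m \<in> space M. w 0 m = i}) \<longlonglongrightarrow> 0)"

definition ms_stabilizable ::
  "'m measure \<Rightarrow> (nat \<Rightarrow> 'm \<Rightarrow> 's) \<Rightarrow>
   ('s \<Rightarrow> real^'d^'d) \<Rightarrow> ('s \<Rightarrow> real^'k^'d) \<Rightarrow> bool" where
  "ms_stabilizable M w A B \<longleftrightarrow> (\<exists>K. ms_stabilizing M w A B K)"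

definition mu :: "('s::finite \<Rightarrow> real) \<Rightarrow> (real^'d) measure \<Rightarrow> real" where
  "mu \<pi> D = Min (range \<pi>) * sigma_min (second_moment D)"

text \<open>An extended real, so that the quotient is \<open>\<infinity>\<close> (rather than 0) when all \<open>B i\<close>
  vanish and the restriction is void.\<close>
definition radius ::
  "('s::finite \<Rightarrow> real) \<Rightarrow> (real^'d) measure \<Rightarrow>
   ('s \<Rightarrow> real^'d^'d) \<Rightarrow> ('s \<Rightarrow> real^'k^'d) \<Rightarrow> ('s \<Rightarrow> real^'d^'d) \<Rightarrow> ('s \<Rightarrow> real^'d^'k) \<Rightarrow>
   real \<Rightarrow> ereal" where
  "radius \<pi> D A B Q K c =
     min (ereal (Lambda_min Q * mu \<pi> D) /
            ereal (4 * c * (\<Sum>i\<in>UNIV. mat_norm (B i) * (mat_norm (A i - B i ** K i) + 1))))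
         (ereal (\<Sum>i\<in>UNIV. mat_norm (K i)))"

end

theory Submission
  imports Defs
begin

text \<open>
  For a policy with closed loop \<open>L\<close>, let \<open>V\<^sub>n\<close> be the expected cost of the first \<open>n\<close> stages as a
  function of the initial mode and state; it is a quadratic form obeying
  \<open>V\<^sub>n\<^sub>+\<^sub>1 i x = c i x + (\<Sum>j. p i j * V\<^sub>n j (L i x))\<close>. Let \<open>U\<^sub>n\<close> be the same iteration for the stage
  cost \<open>(norm x)\<^sup>2\<close>, so that \<open>\<Lambda>\<^sub>m\<^sub>i\<^sub>n(Q) U\<^sub>n \<le> V\<^sub>n\<close>. Since \<open>\<pi>\<close> and the second moment of \<open>x\<^sub>0\<close> are bounded
  below, a finite cost gives \<open>U\<^sub>n i x \<le> \<kappa> (norm x)\<^sup>2\<close> with \<open>\<kappa> = C(K) / (\<Lambda>\<^sub>m\<^sub>i\<^sub>n(Q) \<mu>)\<close>. Inside the stated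
  radius, replacing \<open>L\<close> by \<open>L'\<close> changes one step of the recursion for \<open>U\<^sub>n\<close> by at most
  \<open>(norm x)\<^sup>2 / 2\<close>, whence \<open>U'\<^sub>n \<le> 2 U\<^sub>n\<close>. The difference \<open>V'\<^sub>n - V\<^sub>n\<close> satisfies the recursion of the
  perturbed loop with a source of size \<open>H (norm x)\<^sup>2\<close>, \<open>H\<close> proportional to the distance of the
  policies, so it is at most \<open>H U'\<^sub>n \<le> 2 H U\<^sub>n \<le> (2 H / \<Lambda>\<^sub>m\<^sub>i\<^sub>n(Q)) V\<^sub>n\<close>, uniformly in \<open>n\<close>.
\<close>

section \<open>Quadratic forms and singular values\<close>

definition psd :: "real^'n^'n \<Rightarrow> bool" where
  "psd G \<longleftrightarrow> transpose G = G \<and> (\<forall>x. 0 \<le> x \<bullet> (G *v x))"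

lemma psd_nonneg: "psd G \<Longrightarrow> 0 \<le> x \<bullet> (G *v x)"
  by (simp add: psd_def)

lemma pos_def_imp_psd: "pos_def G \<Longrightarrow> psd G"
  by (metis inner_zero_left less_imp_le order_refl pos_def_def psd_def)

lemma symmetric_dot_commute:
  fixes G :: "real^'n^'n"
  assumes "transpose G = G"
  shows "x \<bullet> (G *v y) = y \<bullet> (G *v x)"
  by (metis assms dot_lmul_matrix inner_commute vector_transpose_matrix)

lemma quadratic_form_add:
  fixes G :: "real^'n^'n"
  assumes "transpose G = G"
  shows "(x + y) \<bullet> (G *v (x + y)) = x \<bullet> (G *v x) + 2 * (x \<bullet> (G *v y)) + y \<bullet> (G *v y)"
  using symmetric_dot_commute[OF assms, of y x]
  by (simp add: matrix_vector_right_distrib inner_add_left inner_add_right)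

text \<open>As a polynomial in \<open>t\<close>, the form at \<open>x + t *\<^sub>R y\<close> never
  becomes negative; the inequality is the resulting sign of its discriminant. \<open>G\<close> may
  be singular, so a vanishing leading coefficient is a case of its own.\<close>

lemma psd_cauchy_schwarz:
  assumes "psd G"
  shows "(x \<bullet> (G *v y))\<^sup>2 \<le> (x \<bullet> (G *v x)) * (y \<bullet> (G *v y))"
proof -
  define a b c where "a = x \<bullet> (G *v x)" and "b = x \<bullet> (G *v y)" and "c = y \<bullet> (G *v y)"
  have sym: "transpose G = G" using assms by (simp add: psd_def)
  have pos: "0 \<le> a + 2 * t * b + t\<^sup>2 * c" for t
  proof -
    have "0 \<le> (x + t *\<^sub>R y) \<bullet> (G *v (x + t *\<^sub>R y))"
      by (rule psd_nonneg[OF assms])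
    also have "\<dots> = a + 2 * t * b + t\<^sup>2 * c"
      unfolding quadratic_form_add[OF sym] a_def b_def c_def
      by (simp add: matrix_vector_mult_scaleR power2_eq_square)
    finally show ?thesis .
  qed
  have "0 \<le> c" using psd_nonneg[OF assms] by (simp add: c_def)
  have "b\<^sup>2 \<le> a * c"
  proof (cases "c = 0")
    case True
    have "b = 0"
    proof (rule ccontr)
      assume "b \<noteq> 0"
      \<comment> \<open>With \<open>c = 0\<close> the polynomial is affine in \<open>t\<close>; this
        \<open>t\<close> makes its value -1.\<close>
      then show False using pos[of "- (a + 1) / (2 * b)"] True by (simp add: field_simps)
    qed
    then show ?thesis using True by simp
  next
    case False
    then have "0 < c" using \<open>0 \<le> c\<close> by simp
    \<comment> \<open>\<open>- b / c\<close> minimizes the polynomial; the factor \<open>c\<close>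
      clears the denominator.\<close>
    have "0 \<le> c * (a + 2 * (- b / c) * b + (- b / c)\<^sup>2 * c)"
      using pos[of "- b / c"] \<open>0 \<le> c\<close> by (intro mult_nonneg_nonneg)
    also have "\<dots> = a * c - b\<^sup>2" using False by (simp add: field_simps power2_eq_square)
    finally show ?thesis by simp
  qed
  then show ?thesis by (simp add: a_def b_def c_def)
qed

text \<open>After expansion the cross term is controlled by \<open>psd_cauchy_schwarz\<close> and
  the last term by the bound itself, so a bound on the form stands in for a norm of
  \<open>G\<close>.\<close>

lemma psd_perturb:
  assumes "psd G" and "0 \<le> v" and bound: "\<And>x. x \<bullet> (G *v x) \<le> v * (norm x)\<^sup>2"
  shows "\<bar>(y + z) \<bullet> (G *v (y + z)) - y \<bullet> (G *v y)\<bar> \<le> v * (2 * norm y * norm z + (norm z)\<^sup>2)"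
proof -
  have sym: "transpose G = G" using assms by (simp add: psd_def)
  have "(y \<bullet> (G *v z))\<^sup>2 \<le> (y \<bullet> (G *v y)) * (z \<bullet> (G *v z))"
    by (rule psd_cauchy_schwarz[OF assms(1)])
  also have "\<dots> \<le> (v * (norm y)\<^sup>2) * (v * (norm z)\<^sup>2)"
    using bound psd_nonneg[OF assms(1)] assms(2) by (intro mult_mono) auto
  also have "\<dots> = (v * norm y * norm z)\<^sup>2" by (simp add: power2_eq_square)
  finally have "\<bar>y \<bullet> (G *v z)\<bar> \<le> v * norm y * norm z"
    using assms(2) by (metis abs_le_square_iff abs_of_nonneg mult_nonneg_nonneg norm_ge_zero)
  then show ?thesis
    using bound[of z] psd_nonneg[OF assms(1), of z]
    unfolding quadratic_form_add[OF sym] by (simp add: algebra_simps abs_le_iff)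
qed

lemma matrix_scaleR_vector_mult: "(c *\<^sub>R G) *v x = c *\<^sub>R (G *v (x::real^'n))"
  by (simp add: scaleR_matrix_vector_assoc)

text \<open>After subtracting its minimum on the unit sphere, the form is positive semidefinite and
  vanishes at the minimizer, so Cauchy-Schwarz makes the minimizer an eigenvector.\<close>
lemma symmetric_min_eigenvalue:
  fixes S :: "real^'n^'n"
  assumes sym: "transpose S = S"
  obtains v l where "norm v = 1" "S *v v = l *\<^sub>R v" "\<And>x. l * (norm x)\<^sup>2 \<le> x \<bullet> (S *v x)"
proof -
  have "continuous_on (sphere 0 1) (\<lambda>x. x \<bullet> (S *v x))"
    by (intro continuous_intros linear_continuous_on matrix_vector_mul_bounded_linear)
  moreover have "compact (sphere (0::real^'n) 1)" "sphere (0::real^'n) 1 \<noteq> {}" by auto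
  ultimately obtain v where v: "v \<in> sphere 0 1"
    and min: "\<And>x. x \<in> sphere 0 1 \<Longrightarrow> v \<bullet> (S *v v) \<le> x \<bullet> (S *v x)"
    using continuous_attains_inf[of "sphere 0 1" "\<lambda>x. x \<bullet> (S *v x)"] by blast
  define l where "l = v \<bullet> (S *v v)"
  have nv: "norm v = 1" using v by simp
  have bound: "l * (norm x)\<^sup>2 \<le> x \<bullet> (S *v x)" for x
  proof (cases "x = 0")
    case False
    have "l \<le> sgn x \<bullet> (S *v sgn x)"
      using min[of "sgn x"] False by (simp add: l_def norm_sgn)
    also have "\<dots> = (x \<bullet> (S *v x)) / (norm x)\<^sup>2"
      by (simp add: sgn_div_norm matrix_vector_mult_scaleR power2_eq_square divide_inverse)
    finally show ?thesis using False by (simp add: pos_le_divide_eq)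
  qed simp
  define T where "T = S - l *\<^sub>R mat 1"
  have T: "T *v x = S *v x - l *\<^sub>R x" for x
    by (simp add: T_def matrix_vector_mult_diff_rdistrib matrix_scaleR_vector_mult)
  have "transpose T = T"
    using sym by (simp add: T_def transpose_def vec_eq_iff mat_def)
  then have "psd T"
    using bound by (simp add: psd_def T inner_diff_right power2_norm_eq_inner)
  have "v \<bullet> (T *v v) = 0"
    using nv by (simp add: T inner_diff_right l_def power2_norm_eq_inner[symmetric])
  \<comment> \<open>With \<open>T *v v\<close> itself as first argument, the left-hand side is the
    fourth power of its norm.\<close>
  then have "((T *v v) \<bullet> (T *v v))\<^sup>2 \<le> 0"
    using psd_cauchy_schwarz[OF \<open>psd T\<close>, of "T *v v" v] by simp
  then have "S *v v = l *\<^sub>R v" by (simp add: T)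
  then show ?thesis using that nv bound by blast
qed

section \<open>Singular values of a single matrix\<close>

lemma gram_dot: "x \<bullet> ((transpose A ** A) *v y) = (A *v x) \<bullet> (A *v (y::real^'n))"
  for A :: "real^'n^'m"
  by (metis dot_lmul_matrix inner_commute matrix_vector_mul_assoc transpose_matrix_vector)

lemma transpose_gram: "transpose (transpose A ** A) = transpose A ** (A::real^'n^'m)"
  by (simp add: matrix_transpose_mul)

text \<open>Finiteness gives \<open>Max\<close> and \<open>Min\<close> in \<open>mat_norm\<close>
  and \<open>sigma_min\<close> their meaning. Distinct singular values are nonnegative, hence have
  distinct squares, so their eigenvectors for the symmetric Gram matrix are orthogonal, and a
  pairwise orthogonal set in finite dimension is finite.\<close>

lemma finite_singular_values:
  fixes A :: "real^'n^'m"
  shows "finite (singular_values A)"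
proof -
  define S where "S = transpose A ** A"
  have sym: "transpose S = S" by (simp add: S_def transpose_gram)
  define ev where "ev s = (SOME v. v \<noteq> 0 \<and> S *v v = s\<^sup>2 *\<^sub>R v)" for s
  have ev: "ev s \<noteq> 0 \<and> S *v ev s = s\<^sup>2 *\<^sub>R ev s" if "s \<in> singular_values A" for s
    unfolding ev_def
    by (rule someI_ex) (use that in \<open>auto simp: singular_values_def S_def\<close>)
  have orth: "orthogonal (ev s) (ev t)"
    if "s \<in> singular_values A" "t \<in> singular_values A" "s \<noteq> t" for s t
  proof -
    have "s\<^sup>2 * (ev t \<bullet> ev s) = t\<^sup>2 * (ev s \<bullet> ev t)"
      using symmetric_dot_commute[OF sym, of "ev t" "ev s"] ev that by simp
    moreover have "s\<^sup>2 \<noteq> t\<^sup>2" using that by (auto simp: singular_values_def power2_eq_iff)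
    ultimately show ?thesis by (simp add: orthogonal_def inner_commute)
  qed
  have inj: "inj_on ev (singular_values A)"
  proof (rule inj_onI, rule ccontr)
    fix s t assume *: "s \<in> singular_values A" "t \<in> singular_values A" "ev s = ev t" "s \<noteq> t"
    then have "orthogonal (ev s) (ev s)" using orth by metis
    then show False using ev * by (simp add: orthogonal_self)
  qed
  have "pairwise orthogonal (ev ` singular_values A)"
    unfolding pairwise_def using orth by auto
  then have "finite (ev ` singular_values A)"
    by (rule pairwise_orthogonal_imp_finite)
  then show ?thesis using inj finite_imageD by blast
qed

lemma singular_valueI:
  fixes A :: "real^'n^'m"
  assumes "0 \<le> s" "v \<noteq> 0" "(transpose A ** A) *v v = s\<^sup>2 *\<^sub>R v"
  shows "s \<in> singular_values A"
  using assms by (auto simp: singular_values_def)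

text \<open>The Gram matrix is negated so that \<open>symmetric_min_eigenvalue\<close> delivers its
  largest eigenvalue \<open>- l\<close>. The root of \<open>- l\<close> is a singular value, hence
  at most the maximum, and it already bounds how far \<open>A\<close> stretches a vector.\<close>

lemma norm_mult_le_mat_norm:
  fixes A :: "real^'n^'m"
  shows "norm (A *v x) \<le> mat_norm A * norm x"
proof -
  define S where "S = - (transpose A ** A)"
  have "transpose S = S"
    using transpose_gram[of A] by (simp add: S_def transpose_def vec_eq_iff)
  then obtain v l where v: "norm v = 1" "S *v v = l *\<^sub>R v"
    and b: "\<And>x. l * (norm x)\<^sup>2 \<le> x \<bullet> (S *v x)"
    using symmetric_min_eigenvalue by blast
  have S: "S *v x = - ((transpose A ** A) *v x)" for x
    using matrix_vector_mult_diff_rdistrib[of 0 "transpose A ** A" x] by (simp add: S_def)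
  have bound: "(norm (A *v x))\<^sup>2 \<le> (- l) * (norm x)\<^sup>2" for x
    using b[of x] by (simp add: S gram_dot power2_norm_eq_inner)
  have "0 \<le> - l" using order_trans[OF zero_le_power2 bound[of v]] v(1) by simp
  have "sqrt (- l) \<in> singular_values A"
    using v \<open>0 \<le> - l\<close> by (intro singular_valueI[of _ v]) (auto simp: S neg_equal_iff_equal minus_equation_iff)
  then have "sqrt (- l) \<le> mat_norm A"
    unfolding mat_norm_def by (intro Max_ge finite_singular_values)
  then have "sqrt (-l) * norm x \<le> mat_norm A * norm x" by (intro mult_right_mono) auto
  moreover have "norm (A *v x) \<le> sqrt (- l) * norm x"
    using real_sqrt_le_mono[OF bound[of x]] by (simp only: real_sqrt_mult real_sqrt_abs abs_norm_cancel)
  ultimately show ?thesis by simp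
qed

lemma mat_norm_nonneg: "0 \<le> mat_norm (A :: real^'n^'m)"
proof -
  have "0 \<le> norm (A *v axis undefined 1)" by simp
  also have "\<dots> \<le> mat_norm A * norm (axis undefined 1 :: real^'n)"
    by (rule norm_mult_le_mat_norm)
  finally show ?thesis by simp
qed

lemma mat_norm_minus: "mat_norm (- A) = mat_norm (A :: real^'n^'m)"
proof -
  have "transpose (- A) ** (- A) = transpose A ** A"
    by (simp add: transpose_def matrix_matrix_mult_def vec_eq_iff)
  then show ?thesis by (simp add: mat_norm_def singular_values_def)
qed

text \<open>For symmetric \<open>A\<close> the Gram matrix is the square of \<open>A\<close>, so the
  least eigenvalue of \<open>A\<close>, being positive, is also a singular value.\<close>

lemma pos_def_min_eigenvalue:
  assumes "pos_def A"
  obtains l where "l \<in> singular_values A" "0 < l" "\<And>x. l * (norm x)\<^sup>2 \<le> x \<bullet> (A *v x)"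
proof -
  from assms have "transpose A = A" by (simp add: pos_def_def)
  then obtain v l where v: "norm v = 1" "A *v v = l *\<^sub>R v"
    and b: "\<And>x. l * (norm x)\<^sup>2 \<le> x \<bullet> (A *v x)"
    using symmetric_min_eigenvalue by blast
  have "v \<noteq> 0" using v by auto
  then have "0 < v \<bullet> (A *v v)" using assms by (simp add: pos_def_def)
  then have "0 < l" using v by (simp add: power2_norm_eq_inner[symmetric])
  moreover have "l \<in> singular_values A"
    using v \<open>0 < l\<close> \<open>v \<noteq> 0\<close> \<open>transpose A = A\<close>
    by (intro singular_valueI[of _ v])
      (auto simp: matrix_vector_mul_assoc[symmetric] matrix_vector_mult_scaleR power2_eq_square)
  ultimately show ?thesis using that b by blast
qed

lemma sigma_min_le_quadratic_form:
  assumes "pos_def A"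
  shows "sigma_min A * (norm x)\<^sup>2 \<le> x \<bullet> (A *v x)"
proof -
  obtain l where l: "l \<in> singular_values A" "\<And>x. l * (norm x)\<^sup>2 \<le> x \<bullet> (A *v x)"
    using pos_def_min_eigenvalue[OF assms] by blast
  have "sigma_min A \<le> l"
    unfolding sigma_min_def by (intro Min_le finite_singular_values l)
  then show ?thesis using l(2)[of x] by (meson mult_right_mono order_trans zero_le_power2)
qed

text \<open>The minimum is attained. Were it 0, its eigenvector would be annihilated by the Gram
  matrix and hence by \<open>A\<close>, against definiteness.\<close>

lemma sigma_min_pos:
  assumes "pos_def A"
  shows "0 < sigma_min A"
proof -
  have "singular_values A \<noteq> {}" using pos_def_min_eigenvalue[OF assms] by blast
  then have "sigma_min A \<in> singular_values A"
    unfolding sigma_min_def by (intro Min_in finite_singular_values)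
  then obtain v where v: "0 \<le> sigma_min A" "v \<noteq> 0"
    "(transpose A ** A) *v v = (sigma_min A)\<^sup>2 *\<^sub>R v"
    by (auto simp: singular_values_def)
  have "A *v v \<noteq> 0" using assms v(2) by (force simp: pos_def_def)
  then have "v \<bullet> ((transpose A ** A) *v v) \<noteq> 0" by (simp add: gram_dot)
  then show ?thesis using v by (cases "sigma_min A = 0") auto
qed

section \<open>Norms and least singular values of tuples\<close>

lemma mat_norm_le_tuple_norm: "mat_norm (V i) \<le> tuple_norm V"
  for V :: "'s::finite \<Rightarrow> real^'n^'m"
  unfolding tuple_norm_def by (intro Max_ge) auto

lemma norm_mult_le_tuple_norm:
  fixes V :: "'s::finite \<Rightarrow> real^'n^'m"
  shows "norm (V i *v x) \<le> tuple_norm V * norm x"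
  by (meson mat_norm_le_tuple_norm mult_right_mono norm_ge_zero norm_mult_le_mat_norm order_trans)

lemma tuple_norm_nonneg: "0 \<le> tuple_norm V"
  for V :: "'s::finite \<Rightarrow> real^'n^'m"
  using mat_norm_le_tuple_norm[of V undefined] mat_norm_nonneg[of "V undefined"] by simp

lemma tuple_norm_minus_commute: "tuple_norm (\<lambda>i. V i - W i) = tuple_norm (\<lambda>i. W i - V i)"
  for V :: "'s::finite \<Rightarrow> real^'n^'m"
proof -
  have "mat_norm (V i - W i) = mat_norm (W i - V i)" for i
    using mat_norm_minus[of "V i - W i"] by simp
  then show ?thesis by (simp add: tuple_norm_def)
qed

lemma Lambda_min_pos:
  fixes Q :: "'s::finite \<Rightarrow> real^'n^'n"
  assumes "\<And>i. pos_def (Q i)"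
  shows "0 < Lambda_min Q"
  unfolding Lambda_min_def using assms by (subst Min_gr_iff) (auto intro: sigma_min_pos)

lemma Lambda_min_le_quadratic_form:
  fixes Q :: "'s::finite \<Rightarrow> real^'n^'n"
  assumes "\<And>i. pos_def (Q i)"
  shows "Lambda_min Q * (norm x)\<^sup>2 \<le> x \<bullet> (Q i *v x)"
proof -
  have "Lambda_min Q \<le> sigma_min (Q i)" unfolding Lambda_min_def by (intro Min_le) auto
  then show ?thesis
    by (meson assms mult_right_mono order_trans sigma_min_le_quadratic_form zero_le_power2)
qed

lemma quadratic_form_le_tuple_norm:
  fixes Q :: "'s::finite \<Rightarrow> real^'n^'n"
  shows "x \<bullet> (Q i *v x) \<le> tuple_norm Q * (norm x)\<^sup>2"
proof -
  have "x \<bullet> (Q i *v x) \<le> norm x * norm (Q i *v x)" by (rule norm_cauchy_schwarz)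
  also have "\<dots> \<le> norm x * (tuple_norm Q * norm x)"
    by (intro mult_left_mono norm_mult_le_tuple_norm) auto
  finally show ?thesis by (simp add: power2_eq_square algebra_simps)
qed

text \<open>Value functions arise by sums, nonnegative multiples and linear substitutions. Treating
  forms as functions that merely admit a matrix lets closure under these operations replace explicit
  matrix recursions.\<close>

definition psd_form :: "(real^'n \<Rightarrow> real) \<Rightarrow> bool" where
  "psd_form q \<longleftrightarrow> (\<exists>G. psd G \<and> q = (\<lambda>x. x \<bullet> (G *v x)))"

lemma psd_formI: "psd G \<Longrightarrow> psd_form (\<lambda>x. x \<bullet> (G *v x))"
  by (auto simp: psd_form_def)

lemma psd_form_nonneg: "psd_form q \<Longrightarrow> 0 \<le> q x"
  by (auto simp: psd_form_def psd_nonneg)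

lemma psd_form_continuous: "psd_form q \<Longrightarrow> continuous_on UNIV q"
  unfolding psd_form_def
  by (auto intro!: continuous_on_inner continuous_on_id
      linear_continuous_on[OF matrix_vector_mul_bounded_linear])

lemma psd_form_measurable: "psd_form q \<Longrightarrow> q \<in> borel_measurable borel"
  by (intro borel_measurable_continuous_onI psd_form_continuous)

lemma psd_form_zero: "psd_form (\<lambda>x. 0)"
  unfolding psd_form_def
  by (intro exI[of _ 0]) (simp add: psd_def transpose_def vec_eq_iff)

lemma psd_form_add:
  assumes "psd_form q" "psd_form r"
  shows "psd_form (\<lambda>x. q x + r x)"
proof -
  obtain G H where G: "psd G" "q = (\<lambda>x. x \<bullet> (G *v x))" and H: "psd H" "r = (\<lambda>x. x \<bullet> (H *v x))"
    using assms unfolding psd_form_def by blast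
  have *: "(\<lambda>x. q x + r x) = (\<lambda>x. x \<bullet> ((G + H) *v x))"
    by (simp add: G H matrix_vector_mult_add_rdistrib inner_add_right)
  have "transpose (G + H) = transpose G + transpose H"
    by (simp add: transpose_def vec_eq_iff)
  then have "psd (G + H)"
    using G(1) H(1) by (simp add: psd_def matrix_vector_mult_add_rdistrib inner_add_right)
  then show ?thesis unfolding * by (rule psd_formI)
qed

lemma psd_form_scale:
  assumes "psd_form q" "0 \<le> a"
  shows "psd_form (\<lambda>x. a * q x)"
proof -
  obtain G where G: "psd G" "q = (\<lambda>x. x \<bullet> (G *v x))"
    using assms unfolding psd_form_def by blast
  have *: "(\<lambda>x. a * q x) = (\<lambda>x. x \<bullet> ((a *\<^sub>R G) *v x))"
    by (simp add: G matrix_scaleR_vector_mult)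
  have "transpose (a *\<^sub>R G) = a *\<^sub>R transpose G"
    by (simp add: transpose_def vec_eq_iff)
  then have "psd (a *\<^sub>R G)"
    using G(1) assms(2) by (simp add: psd_def matrix_scaleR_vector_mult)
  then show ?thesis unfolding * by (rule psd_formI)
qed

lemma psd_form_sum:
  assumes "\<And>j. j \<in> J \<Longrightarrow> psd_form (q j)"
  shows "psd_form (\<lambda>x. \<Sum>j\<in>J. q j x)"
  using assms
  by (induction J rule: infinite_finite_induct) (auto intro: psd_form_zero psd_form_add)

lemma psd_form_compose:
  fixes L :: "real^'n^'m"
  assumes "psd_form q"
  shows "psd_form (\<lambda>x. q (L *v x))"
proof -
  obtain G where G: "psd G" "q = (\<lambda>x. x \<bullet> (G *v x))"
    using assms unfolding psd_form_def by blast
  have *: "(L *v x) \<bullet> (G *v (L *v x)) = x \<bullet> ((transpose L ** G ** L) *v x)" for x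
    by (simp add: matrix_vector_mul_assoc[symmetric] dot_lmul_matrix[symmetric])
       (metis dot_lmul_matrix inner_commute)
  have "transpose (transpose L ** G ** L) = transpose L ** G ** L"
    using G(1) by (simp add: psd_def matrix_transpose_mul matrix_mul_assoc)
  then have "psd (transpose L ** G ** L)"
    using psd_nonneg[OF G(1)] unfolding psd_def *[symmetric] by simp
  then have "psd_form (\<lambda>x. x \<bullet> ((transpose L ** G ** L) *v x))" by (rule psd_formI)
  then show ?thesis by (simp add: G *)
qed

lemma psd_form_norm: "psd_form (\<lambda>x :: real^'n. (norm x)\<^sup>2)"
proof -
  have "psd (mat 1 :: real^'n^'n)" by (simp add: psd_def)
  from psd_formI[OF this] show ?thesis by (simp add: power2_norm_eq_inner)
qed

lemma psd_form_perturb: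
  assumes "psd_form q" and "0 \<le> v" and "\<And>x. q x \<le> v * (norm x)\<^sup>2"
  shows "\<bar>q (y + z) - q y\<bar> \<le> v * (2 * norm y * norm z + (norm z)\<^sup>2)"
  using assms psd_perturb unfolding psd_form_def by blast

section \<open>Value iteration and its perturbation\<close>

text \<open>The conditional expectation of \<open>q\<close> at the next mode and state, given the
  present mode \<open>i\<close> and state \<open>x\<close>, when \<open>L\<close> is the closed
  loop.\<close>

definition mode_step ::
  "('s::finite \<Rightarrow> 's \<Rightarrow> real) \<Rightarrow> ('s \<Rightarrow> real^'d^'d) \<Rightarrow> ('s \<Rightarrow> real^'d \<Rightarrow> real) \<Rightarrow> 's \<Rightarrow> real^'d \<Rightarrow> real" where
  "mode_step p L q i x = (\<Sum>j\<in>UNIV. p i j * q j (L i *v x))"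

primrec value_iter ::
  "('s::finite \<Rightarrow> 's \<Rightarrow> real) \<Rightarrow> ('s \<Rightarrow> real^'d^'d) \<Rightarrow> ('s \<Rightarrow> real^'d \<Rightarrow> real) \<Rightarrow> nat \<Rightarrow> 's \<Rightarrow> real^'d \<Rightarrow> real" where
  "value_iter p L c 0 = (\<lambda>i x. 0)"
| "value_iter p L c (Suc n) = (\<lambda>i x. c i x + mode_step p L (value_iter p L c n) i x)"

definition sqnorm_cost :: "'s \<Rightarrow> real^'d \<Rightarrow> real" where
  "sqnorm_cost i x = (norm x)\<^sup>2"

locale transition_matrix =
  fixes p :: "'s::finite \<Rightarrow> 's \<Rightarrow> real"
  assumes p_nonneg: "\<And>i j. 0 \<le> p i j"
    and p_sum: "\<And>i. (\<Sum>j\<in>UNIV. p i j) = 1"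
begin

lemma psd_form_mode_step:
  assumes "\<And>j. psd_form (q j)"
  shows "psd_form (mode_step p L q i)"
  unfolding mode_step_def
  by (intro psd_form_sum psd_form_scale psd_form_compose assms p_nonneg)

lemma psd_form_value_iter:
  assumes "\<And>j. psd_form (c j)"
  shows "psd_form (value_iter p L c n i)"
proof (induction n arbitrary: i)
  case (Suc n)
  then show ?case by (simp add: psd_form_add psd_form_mode_step assms)
qed (simp add: psd_form_zero)

lemma mode_step_mono:
  assumes "\<And>j x. q j x \<le> r j x"
  shows "mode_step p L q i x \<le> mode_step p L r i x"
  unfolding mode_step_def by (intro sum_mono mult_left_mono assms p_nonneg)

lemma mode_step_scale: "mode_step p L (\<lambda>j x. a * q j x) i x = a * mode_step p L q i x"
  by (simp add: mode_step_def sum_distrib_left algebra_simps)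

lemma mode_step_diff:
  "mode_step p L (\<lambda>j x. q j x - r j x) i x = mode_step p L q i x - mode_step p L r i x"
  by (simp add: mode_step_def sum_subtractf algebra_simps)

lemma abs_mode_step_le: "\<bar>mode_step p L q i x\<bar> \<le> mode_step p L (\<lambda>j x. \<bar>q j x\<bar>) i x"
  unfolding mode_step_def by (rule order_trans[OF sum_abs]) (simp add: abs_mult p_nonneg)

text \<open>The iteration is monotone and homogeneous in the stage cost; with the factor
  \<open>a\<close>, pointwise comparisons between stage costs and the squared norm pass to all
  horizons.\<close>

lemma value_iter_mono:
  assumes "\<And>j x. c j x \<le> a * d j x"
  shows "value_iter p L c n i x \<le> a * value_iter p L d n i x"
proof (induction n arbitrary: i x)
  case (Suc n)
  have "mode_step p L (value_iter p L c n) i x \<le> mode_step p L (\<lambda>j x. a * value_iter p L d n j x) i x"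
    by (intro mode_step_mono Suc)
  then show ?case using assms[of i x] by (simp add: mode_step_scale algebra_simps)
qed simp

text \<open>Each \<open>q j\<close> moves by at most the amount in \<open>psd_form_perturb\<close>,
  and averaging with weights of sum 1 keeps that bound. The bounds \<open>l\<close> and
  \<open>b\<close> concern only the given \<open>i\<close> and \<open>x\<close>, so they may be
  chosen mode by mode.\<close>

lemma mode_step_perturb:
  assumes psd: "\<And>j. psd_form (q j)" and v: "0 \<le> v" "\<And>j x. q j x \<le> v * (norm x)\<^sup>2"
    and l: "norm (L i *v x) \<le> l * norm x" and b: "norm (L' i *v x - L i *v x) \<le> b * norm x"
    and "0 \<le> l" "0 \<le> b"
  shows "\<bar>mode_step p L' q i x - mode_step p L q i x\<bar> \<le> v * (2 * l * b + b\<^sup>2) * (norm x)\<^sup>2"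
proof -
  define y z where "y = L i *v x" and "z = L' i *v x - L i *v x"
  have "\<bar>q j (y + z) - q j y\<bar> \<le> v * (2 * l * b + b\<^sup>2) * (norm x)\<^sup>2" for j
  proof -
    have "\<bar>q j (y + z) - q j y\<bar> \<le> v * (2 * (norm y * norm z) + (norm z)\<^sup>2)"
      using psd_form_perturb[OF psd v] by (simp add: mult.assoc)
    also have "\<dots> \<le> v * (2 * ((l * norm x) * (b * norm x)) + (b * norm x)\<^sup>2)"
      using assms unfolding y_def z_def
      by (intro mult_left_mono add_mono mult_mono power_mono) auto
    finally show ?thesis by (simp add: power2_eq_square algebra_simps)
  qed
  then have *: "p i j * \<bar>q j (y + z) - q j y\<bar> \<le> p i j * (v * (2 * l * b + b\<^sup>2) * (norm x)\<^sup>2)" for j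
    by (intro mult_left_mono p_nonneg)
  have "mode_step p L' q i x - mode_step p L q i x = (\<Sum>j\<in>UNIV. p i j * (q j (y + z) - q j y))"
    by (simp add: mode_step_def y_def z_def sum_subtractf algebra_simps)
  also have "\<bar>\<dots>\<bar> \<le> (\<Sum>j\<in>UNIV. \<bar>p i j * (q j (y + z) - q j y)\<bar>)" by (rule sum_abs)
  also have "\<dots> \<le> (\<Sum>j\<in>UNIV. p i j * (v * (2 * l * b + b\<^sup>2) * (norm x)\<^sup>2))"
    using * by (intro sum_mono) (simp add: abs_mult p_nonneg)
  also have "\<dots> = v * (2 * l * b + b\<^sup>2) * (norm x)\<^sup>2"
    by (simp add: sum_distrib_right[symmetric] p_sum)
  finally show ?thesis .
qed

text \<open>Along the unperturbed loop the value functions drop by \<open>(norm x)\<^sup>2\<close> per step. A perturbation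
  costing at most half of that leaves twice these functions as Lyapunov functions.\<close>
lemma value_iter_sqnorm_perturb:
  assumes k: "0 \<le> k" "\<And>n i x. value_iter p L sqnorm_cost n i x \<le> k * (norm x)\<^sup>2"
    and l: "\<And>i x. norm (L i *v x) \<le> l i * norm x" "\<And>i. 0 \<le> l i"
    and b: "\<And>i x. norm (L' i *v x - L i *v x) \<le> b i * norm x" "\<And>i. 0 \<le> b i"
    and small: "\<And>i. k * (2 * l i * b i + (b i)\<^sup>2) \<le> 1 / 2"
  shows "value_iter p L' sqnorm_cost n i x \<le> 2 * value_iter p L sqnorm_cost n i x"
proof (induction n arbitrary: i x)
  case (Suc n)
  let ?U = "value_iter p L sqnorm_cost n"
  have psd: "psd_form (?U j)" for j
    by (intro psd_form_value_iter) (simp add: sqnorm_cost_def[abs_def] psd_form_norm)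
  have "mode_step p L' (value_iter p L' sqnorm_cost n) i x \<le> mode_step p L' (\<lambda>j x. 2 * ?U j x) i x"
    by (intro mode_step_mono Suc)
  also have "\<dots> = 2 * mode_step p L' ?U i x" by (rule mode_step_scale)
  \<comment> \<open>Doubling the loss of \<open>1 / 2\<close> yields one more
    \<open>(norm x)\<^sup>2\<close>. With the one from the stage cost this makes exactly the two
    copies contained in twice the next iterate.\<close>
  also have "\<dots> \<le> 2 * (mode_step p L ?U i x + 1 / 2 * (norm x)\<^sup>2)"
  proof -
    have "\<bar>mode_step p L' ?U i x - mode_step p L ?U i x\<bar> \<le> k * (2 * l i * b i + (b i)\<^sup>2) * (norm x)\<^sup>2"
      by (intro mode_step_perturb psd k l b)
    also have "\<dots> \<le> 1 / 2 * (norm x)\<^sup>2" by (intro mult_right_mono small) auto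
    finally have "mode_step p L' ?U i x - mode_step p L ?U i x \<le> 1 / 2 * (norm x)\<^sup>2"
      by (rule abs_le_D1)
    then show ?thesis by simp
  qed
  finally show ?case by (simp add: sqnorm_cost_def[of i x])
qed simp

text \<open>The difference splits into the change of stage cost, the change of loop applied to the
  old value function, and the previous difference carried along the new loop. The first two are
  bounded by a multiple of \<open>(norm x)\<^sup>2\<close>; the third propagates them just as the
  squared-norm iteration for \<open>L'\<close> does.\<close>

lemma value_iter_perturb:
  assumes psd: "\<And>j. psd_form (c j)"
    and v: "0 \<le> v" "\<And>n i x. value_iter p L c n i x \<le> v * (norm x)\<^sup>2"
    and c: "\<And>i x. \<bar>c' i x - c i x\<bar> \<le> h * (norm x)\<^sup>2"
    and l: "\<And>i x. norm (L i *v x) \<le> l * norm x" "0 \<le> l"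
    and b: "\<And>i x. norm (L' i *v x - L i *v x) \<le> b * norm x" "0 \<le> b"
  shows "\<bar>value_iter p L' c' n i x - value_iter p L c n i x\<bar>
    \<le> (h + v * (2 * l * b + b\<^sup>2)) * value_iter p L' sqnorm_cost n i x"
proof (induction n arbitrary: i x)
  case (Suc n)
  let ?V = "value_iter p L c n" and ?V' = "value_iter p L' c' n"
  let ?H = "h + v * (2 * l * b + b\<^sup>2)"
  let ?D = "mode_step p L' (\<lambda>j x. ?V' j x - ?V j x) i x"
  have "\<bar>mode_step p L' ?V i x - mode_step p L ?V i x\<bar> \<le> v * (2 * l * b + b\<^sup>2) * (norm x)\<^sup>2"
    by (intro mode_step_perturb psd_form_value_iter psd v l b)
  moreover have "\<bar>?D\<bar> \<le> ?H * mode_step p L' (value_iter p L' sqnorm_cost n) i x"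
    unfolding mode_step_scale[symmetric]
    by (intro order_trans[OF abs_mode_step_le] mode_step_mono Suc)
  moreover have "?D = mode_step p L' ?V' i x - mode_step p L' ?V i x" by (rule mode_step_diff)
  moreover note c[of i x]
  moreover have "h * (norm x)\<^sup>2 + v * (2 * l * b + b\<^sup>2) * (norm x)\<^sup>2 = ?H * (norm x)\<^sup>2"
    by (simp add: algebra_simps)
  ultimately have "\<bar>c' i x + mode_step p L' ?V' i x - (c i x + mode_step p L ?V i x)\<bar>
      \<le> ?H * (norm x)\<^sup>2 + ?H * mode_step p L' (value_iter p L' sqnorm_cost n) i x"
    by linarith
  then show ?case by (simp add: sqnorm_cost_def[of i x] distrib_left)
qed simp

end

section \<open>Expected costs along the chain\<close>

lemma state_closed_loop:
  "state A B K h x (Suc t) = (A (h t) - B (h t) ** K (h t)) *v state A B K h x t"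
  \<comment> \<open>The difference law with 0 as first argument moves the minus sign of
    \<open>control\<close> through \<open>B (h t)\<close>.\<close>
  using matrix_vector_mult_diff_distrib[of "B (h t)" 0 "K (h t) *v state A B K h x t"]
  by (simp add: control_def matrix_vector_mult_diff_rdistrib matrix_vector_mul_assoc)

declare state.simps(2) [simp del]

lemma state_cong:
  assumes "\<And>s. s < t \<Longrightarrow> h s = g s"
  shows "state A B K h x t = state A B K g x t"
  using assms by (induction t) (simp_all add: state_closed_loop)

lemma continuous_on_state: "continuous_on UNIV (\<lambda>x. state A B K h x t)"
proof (induction t)
  case (Suc t)
  show ?case unfolding state_closed_loop
    by (intro continuous_on_compose2[OF linear_continuous_on[OF matrix_vector_mul_bounded_linear] Suc]) auto
qed (simp add: continuous_on_id)

locale mjls = prob_space M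
  for M :: "'m measure" +
  fixes w :: "nat \<Rightarrow> 'm \<Rightarrow> 's::finite"
    and x0 :: "'m \<Rightarrow> real^'d"
    and D :: "(real^'d) measure"
    and \<pi> :: "'s \<Rightarrow> real"
    and p :: "'s \<Rightarrow> 's \<Rightarrow> real"
  assumes markov: "markov_chain M w \<pi> p"
    and x0_measurable [measurable]: "x0 \<in> borel_measurable M"
    and distr_x0: "distr M borel x0 = D"
    and indep: "indep_set
           (sets (vimage_algebra (space M) x0 borel))
           (sets (vimage_algebra (space M) (\<lambda>m t. w t m) (\<Pi>\<^sub>M t\<in>UNIV. count_space UNIV)))"
    and init_pos: "\<And>i. \<pi> i > 0"
begin

lemma w_measurable [measurable]: "w t \<in> measurable M (count_space UNIV)"
  using markov by (simp add: markov_chain_def)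

lemma sets_D: "sets D = sets borel"
  using distr_x0 by auto

text \<open>The sigma-algebra generated by the whole trajectory of the chain, written as in the
  independence assumption.\<close>

definition mode_events :: "'m set set" where
  "mode_events = sets (vimage_algebra (space M) (\<lambda>m t. w t m) (\<Pi>\<^sub>M t\<in>UNIV. count_space UNIV))"

text \<open>Independence asks for membership in the generated sigma-algebra, not just in that of
  \<open>M\<close>; it holds because each coordinate is measurable there.\<close>

lemma mode_event:
  assumes "finite S"
  shows "{m \<in> space M. \<forall>s\<in>S. w s m = h s} \<in> mode_events"
proof -
  let ?V = "vimage_algebra (space M) (\<lambda>m t. w t m) (\<Pi>\<^sub>M t\<in>UNIV. count_space UNIV)"
  have "(\<lambda>m t. w t m) \<in> measurable ?V (\<Pi>\<^sub>M t\<in>UNIV. count_space UNIV)"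
    by (rule measurable_vimage_algebra1) (auto simp: space_PiM)
  then have [measurable]: "(\<lambda>m. w s m) \<in> measurable ?V (count_space UNIV)" for s
    using measurable_compose[OF _ measurable_component_singleton, of _ ?V UNIV "\<lambda>_. count_space UNIV" s]
    by simp
  have "{m \<in> space ?V. \<forall>s\<in>S. w s m = h s} \<in> sets ?V"
    using assms by measurable
  then show ?thesis by (simp add: mode_events_def)
qed

text \<open>By independence the law of \<open>x0\<close> restricted to \<open>E\<close> is
  \<open>D\<close> scaled by the probability of \<open>E\<close>. This is checked on Borel sets, and
  equal measures give \<open>f\<close> equal integrals.\<close>

lemma nn_integral_indep:
  assumes E: "E \<in> mode_events" and f [measurable]: "f \<in> borel_measurable borel"
  shows "(\<integral>\<^sup>+m. f (x0 m) * indicator E m \<partial>M) = emeasure M E * (\<integral>\<^sup>+x. f x \<partial>D)"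
proof -
  have Em: "E \<in> sets M"
    using indep_setD_ev2[OF indep] E unfolding mode_events_def by blast
  note [measurable] = this
  have "distr (density M (indicator E)) borel x0 = density D (\<lambda>_. emeasure M E)"
  proof (rule measure_eqI)
    fix A assume "A \<in> sets (distr (density M (indicator E)) borel x0)"
    then have A [measurable]: "A \<in> sets borel" by simp
    have X: "x0 -` A \<inter> space M \<in> sets (vimage_algebra (space M) x0 borel)"
      by (intro in_vimage_algebra A)
    have "emeasure (distr (density M (indicator E)) borel x0) A
        = (\<integral>\<^sup>+m. indicator (x0 -` A \<inter> space M \<inter> E) m \<partial>M)"
      by (auto simp: emeasure_distr emeasure_density indicator_def intro!: nn_integral_cong)
    also have "\<dots> = emeasure M (x0 -` A \<inter> space M \<inter> E)"
      by (intro nn_integral_indicator) measurable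
    also have "\<dots> = emeasure M (x0 -` A \<inter> space M) * emeasure M E"
      using indep_setD[OF indep X E[unfolded mode_events_def]]
      by (simp add: emeasure_eq_measure ennreal_mult)
    also have "emeasure M (x0 -` A \<inter> space M) = emeasure D A"
      unfolding distr_x0[symmetric] by (simp add: emeasure_distr)
    finally show "emeasure (distr (density M (indicator E)) borel x0) A
        = emeasure (density D (\<lambda>_. emeasure M E)) A"
      using A by (simp add: emeasure_density_const sets_D mult.commute)
  qed (simp add: sets_D)
  then have "(\<integral>\<^sup>+x. f x \<partial>distr (density M (indicator E)) borel x0)
      = (\<integral>\<^sup>+x. f x \<partial>density D (\<lambda>_. emeasure M E))" by simp
  moreover have "f \<in> borel_measurable D"
    using f sets_D measurable_cong_sets by blast
  ultimately show ?thesis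
    by (simp add: nn_integral_distr nn_integral_density nn_integral_multc mult.commute)
qed

lemma prob_init: "prob {m \<in> space M. w 0 m = i} = \<pi> i"
  using markov by (simp add: markov_chain_def)

section \<open>Histories of the chain\<close>

definition path_event :: "nat \<Rightarrow> (nat \<Rightarrow> 's) \<Rightarrow> 'm set" where
  "path_event t h = {m \<in> space M. \<forall>s\<le>t. w s m = h s}"

lemma path_event_measurable [measurable]: "path_event t h \<in> sets M"
  unfolding path_event_def by measurable

lemma path_event_mode: "path_event t h \<in> mode_events"
  using mode_event[of "{..t}" h] by (simp add: path_event_def Ball_def)

lemma path_event_Suc_mode: "{m \<in> path_event t h. w (Suc t) m = j} \<in> mode_events"
proof -
  have "{m \<in> path_event t h. w (Suc t) m = j}
      = {m \<in> space M. \<forall>s\<in>{..Suc t}. w s m = (h(Suc t := j)) s}"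
    by (auto simp: path_event_def le_Suc_eq)
  then show ?thesis using mode_event[of "{..Suc t}" "h(Suc t := j)"] by simp
qed

text \<open>\<open>markov_chain\<close> prescribes the transition after histories of positive
  probability; after a null history both sides are 0.\<close>

lemma prob_path_Suc:
  "prob {m \<in> path_event t h. w (Suc t) m = j} = prob (path_event t h) * p (h t) j"
proof (cases "prob (path_event t h) = 0")
  case True
  have "prob {m \<in> path_event t h. w (Suc t) m = j} \<le> prob (path_event t h)"
    by (intro finite_measure_mono) auto
  then show ?thesis using True measure_nonneg[of M "{m \<in> path_event t h. w (Suc t) m = j}"] by simp
next
  case False
  then have "prob (path_event t h) > 0" using measure_nonneg[of M] by (simp add: less_le)
  then have "cond_prob M (\<lambda>m. w (Suc t) m = j) (\<lambda>m. \<forall>s\<le>t. w s m = h s) = p (h t) j"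
    using markov unfolding markov_chain_def path_event_def by blast
  moreover have "{m \<in> path_event t h. w (Suc t) m = j}
      = {m \<in> space M. w (Suc t) m = j \<and> (\<forall>s\<le>t. w s m = h s)}"
    by (auto simp: path_event_def)
  ultimately show ?thesis
    using False by (simp add: cond_prob_def path_event_def field_simps)
qed

text \<open>Every mode has positive initial probability, so every row of \<open>p\<close> is
  realized: the joint law of the first two modes is \<open>\<pi> i * p i j\<close>, and dividing by
  \<open>\<pi> i\<close> shows the row to be a distribution.\<close>

sublocale transition_matrix p
proof
  fix i j
  have e: "path_event 0 (\<lambda>_. i) = {m \<in> space M. w 0 m = i}" by (auto simp: path_event_def)
  have eq: "prob {m \<in> path_event 0 (\<lambda>_. i). w (Suc 0) m = j} = \<pi> i * p i j" for j
    using prob_path_Suc[of 0 "\<lambda>_. i" j] by (simp add: e prob_init)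
  have "0 \<le> \<pi> i * p i j" unfolding eq[symmetric] by simp
  then show "0 \<le> p i j" using init_pos[of i] by (simp add: zero_le_mult_iff)
  have "(\<Sum>j\<in>UNIV. \<pi> i * p i j) = prob (\<Union>j. {m \<in> path_event 0 (\<lambda>_. i). w (Suc 0) m = j})"
    unfolding eq[symmetric]
    by (intro finite_measure_finite_Union[symmetric]) (auto simp: disjoint_family_on_def)
  also have "(\<Union>j. {m \<in> path_event 0 (\<lambda>_. i). w (Suc 0) m = j}) = {m \<in> space M. w 0 m = i}"
    by (auto simp: e)
  finally have "\<pi> i * (\<Sum>j\<in>UNIV. p i j) = \<pi> i" by (simp add: prob_init sum_distrib_left)
  then show "(\<Sum>j\<in>UNIV. p i j) = 1" using init_pos[of i] by simp
qed

text \<open>The histories up to \<open>t\<close> partition the space. Taking them in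
  \<open>PiE\<close>, with a default value beyond \<open>t\<close>, gives a finite index set in
  which each history occurs once.\<close>

lemma nn_integral_paths:
  assumes f: "f \<in> borel_measurable M"
  shows "(\<integral>\<^sup>+m. f m \<partial>M)
    = (\<Sum>h\<in>PiE {..t} (\<lambda>_. UNIV). \<integral>\<^sup>+m. f m * indicator (path_event t h) m \<partial>M)"
proof -
  have fin: "finite (PiE {..t} (\<lambda>_. UNIV :: 's set))" by (intro finite_PiE) auto
  have "f m = (\<Sum>h\<in>PiE {..t} (\<lambda>_. UNIV). f m * indicator (path_event t h) m)"
    if "m \<in> space M" for m
  proof -
    define g where "g = restrict (\<lambda>s. w s m) {..t}"
    have g: "g \<in> PiE {..t} (\<lambda>_. UNIV)" by (auto simp: g_def)
    have "indicator (path_event t h) m = (if h = g then 1 else 0 :: ennreal)"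
      if "h \<in> PiE {..t} (\<lambda>_. UNIV)" for h
    proof -
      have "m \<in> path_event t h \<longleftrightarrow> h = g"
      proof
        assume "m \<in> path_event t h"
        then show "h = g"
          using PiE_arb[OF that] by (auto simp: path_event_def g_def restrict_def fun_eq_iff)
      qed (auto simp: path_event_def g_def \<open>m \<in> space M\<close>)
      then show ?thesis by (simp add: indicator_def)
    qed
    then have "(\<Sum>h\<in>PiE {..t} (\<lambda>_. UNIV). f m * indicator (path_event t h) m)
        = (\<Sum>h\<in>PiE {..t} (\<lambda>_. UNIV). if h = g then f m else 0)"
      by (intro sum.cong) auto
    also have "\<dots> = f m" using g fin by simp
    finally show ?thesis by simp
  qed
  then have "(\<integral>\<^sup>+m. f m \<partial>M)
      = (\<integral>\<^sup>+m. (\<Sum>h\<in>PiE {..t} (\<lambda>_. UNIV). f m * indicator (path_event t h) m) \<partial>M)"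
    by (rule nn_integral_cong)
  also have "\<dots> = (\<Sum>h\<in>PiE {..t} (\<lambda>_. UNIV). \<integral>\<^sup>+m. f m * indicator (path_event t h) m \<partial>M)"
    using f by (intro nn_integral_sum) auto
  finally show ?thesis .
qed

section \<open>Expectations of functions of mode and state\<close>

lemma mode_function_measurable:
  assumes [measurable]: "\<And>i. q i \<in> borel_measurable borel" and [measurable]: "f \<in> borel_measurable M"
  shows "(\<lambda>m. q (w t m) (f m)) \<in> borel_measurable M"
  by (rule measurable_compose_countable[OF _ w_measurable]) measurable

lemma state_measurable [measurable]:
  "(\<lambda>m. state A B K (\<lambda>s. w s m) (x0 m) t) \<in> borel_measurable M"
proof (induction t)
  case (Suc t)
  show ?case unfolding state_closed_loop
    by (rule mode_function_measurable[OF _ Suc, of "\<lambda>i x. (A i - B i ** K i) *v x"])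
      (intro borel_measurable_continuous_onI linear_continuous_on matrix_vector_mul_bounded_linear)
qed simp

definition expected ::
  "('s \<Rightarrow> real^'d^'d) \<Rightarrow> ('s \<Rightarrow> real^'k^'d) \<Rightarrow> ('s \<Rightarrow> real^'d^'k) \<Rightarrow> nat \<Rightarrow> ('s \<Rightarrow> real^'d \<Rightarrow> real) \<Rightarrow> ennreal" where
  "expected A B K t q = (\<integral>\<^sup>+m. ennreal (q (w t m) (state A B K (\<lambda>s. w s m) (x0 m) t)) \<partial>M)"

text \<open>On one history the mode at \<open>t\<close> is constant and the state is a fixed
  function of \<open>x0\<close>, so \<open>nn_integral_indep\<close> factors the integral.\<close>

lemma expected_paths:
  assumes meas: "\<And>i. q i \<in> borel_measurable borel"
  shows "expected A B K t q = (\<Sum>h\<in>PiE {..t} (\<lambda>_. UNIV). emeasure M (path_event t h)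
    * (\<integral>\<^sup>+x. ennreal (q (h t) (state A B K h x t)) \<partial>D))"
proof -
  note [measurable] = meas
  have st [measurable]: "(\<lambda>x. state A B K h x t) \<in> borel_measurable borel" for h
    by (intro borel_measurable_continuous_onI continuous_on_state)
  have eq: "(\<integral>\<^sup>+m. ennreal (q (w t m) (state A B K (\<lambda>s. w s m) (x0 m) t)) * indicator (path_event t h) m \<partial>M)
      = (\<integral>\<^sup>+m. ennreal (q (h t) (state A B K h (x0 m) t)) * indicator (path_event t h) m \<partial>M)" for h
    by (intro nn_integral_cong)
      (auto simp: path_event_def indicator_def cong: state_cong)
  have "(\<integral>\<^sup>+m. ennreal (q (h t) (state A B K h (x0 m) t)) * indicator (path_event t h) m \<partial>M)
      = emeasure M (path_event t h) * (\<integral>\<^sup>+x. ennreal (q (h t) (state A B K h x t)) \<partial>D)" for h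
    by (rule nn_integral_indep[OF path_event_mode, of "\<lambda>x. ennreal (q (h t) (state A B K h x t))"])
      measurable
  with eq show ?thesis unfolding expected_def
    by (subst nn_integral_paths[of _ t]) (auto intro!: measurable_compose[OF mode_function_measurable] meas)
qed

text \<open>Each history is split further by the next mode \<open>j\<close>. Independence and
  \<open>prob_path_Suc\<close> give the pieces the weights \<open>p (h t) j\<close>, which assemble
  to \<open>mode_step\<close>.\<close>

lemma expected_Suc:
  assumes meas: "\<And>i. q i \<in> borel_measurable borel" and nonneg: "\<And>i x. 0 \<le> q i x"
  shows "expected A B K (Suc t) q
    = expected A B K t (mode_step p (\<lambda>i. A i - B i ** K i) q)"
proof -
  note [measurable] = meas
  have lin [measurable]: "(\<lambda>x. G *v x) \<in> borel_measurable borel" for G :: "real^'d^'d"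
    by (intro borel_measurable_continuous_onI linear_continuous_on matrix_vector_mul_bounded_linear)
  have st [measurable]: "(\<lambda>x. state A B K h x t) \<in> borel_measurable borel" for h t
    by (intro borel_measurable_continuous_onI continuous_on_state)
  have step [measurable]: "mode_step p (\<lambda>i. A i - B i ** K i) q i \<in> borel_measurable borel" for i
    unfolding mode_step_def[abs_def] by measurable
  let ?P = "PiE {..t} (\<lambda>_. UNIV :: 's set)"
  define F where "F m = ennreal (q (w (Suc t) m) (state A B K (\<lambda>s. w s m) (x0 m) (Suc t)))" for m
  have [measurable]: "F \<in> borel_measurable M"
    unfolding F_def by (intro measurable_compose[OF mode_function_measurable measurable_ennreal] meas state_measurable)
  define I where "I h j = (\<integral>\<^sup>+x. ennreal (q j (state A B K h x (Suc t))) \<partial>D)" for h j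
  have path: "(\<integral>\<^sup>+m. F m * indicator (path_event t h) m \<partial>M)
      = emeasure M (path_event t h) * (\<Sum>j\<in>UNIV. ennreal (p (h t) j) * I h j)" for h
  proof -
    have "(\<integral>\<^sup>+m. F m * indicator (path_event t h) m \<partial>M)
        = (\<integral>\<^sup>+m. (\<Sum>j\<in>UNIV. ennreal (q j (state A B K h (x0 m) (Suc t)))
            * indicator {m \<in> path_event t h. w (Suc t) m = j} m) \<partial>M)"
    proof (intro nn_integral_cong)
      fix m assume "m \<in> space M"
      show "F m * indicator (path_event t h) m = (\<Sum>j\<in>UNIV. ennreal (q j (state A B K h (x0 m) (Suc t)))
          * indicator {m \<in> path_event t h. w (Suc t) m = j} m)"
      proof (cases "m \<in> path_event t h")
        case True
        \<comment> \<open>The state at \<open>Suc t\<close> is driven by the modes up to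
          \<open>t\<close> only, so the history fixes it whatever the next mode is.\<close>
        then have "state A B K (\<lambda>s. w s m) (x0 m) (Suc t) = state A B K h (x0 m) (Suc t)"
          by (intro state_cong) (auto simp: path_event_def)
        then show ?thesis using True by (simp add: F_def indicator_def if_distrib cong: if_cong)
      qed simp
    qed
    also have "\<dots> = (\<Sum>j\<in>UNIV. \<integral>\<^sup>+m. ennreal (q j (state A B K h (x0 m) (Suc t)))
            * indicator {m \<in> path_event t h. w (Suc t) m = j} m \<partial>M)"
      by (intro nn_integral_sum) measurable
    also have "\<dots> = (\<Sum>j\<in>UNIV. emeasure M {m \<in> path_event t h. w (Suc t) m = j} * I h j)"
      unfolding I_def
      by (intro sum.cong refl nn_integral_indep[OF path_event_Suc_mode]) measurable
    also have "\<dots> = emeasure M (path_event t h) * (\<Sum>j\<in>UNIV. ennreal (p (h t) j) * I h j)"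
      by (simp add: emeasure_eq_measure prob_path_Suc ennreal_mult p_nonneg sum_distrib_left mult.assoc)
    finally show ?thesis .
  qed
  have integral: "(\<Sum>j\<in>UNIV. ennreal (p (h t) j) * I h j)
      = (\<integral>\<^sup>+x. ennreal (mode_step p (\<lambda>i. A i - B i ** K i) q (h t) (state A B K h x t)) \<partial>D)" for h
  proof -
    have [measurable]: "(\<lambda>x. ennreal (q j (state A B K h x (Suc t)))) \<in> borel_measurable D" for j
      unfolding measurable_cong_sets[OF sets_D refl] by measurable
    have "(\<Sum>j\<in>UNIV. ennreal (p (h t) j) * I h j)
        = (\<integral>\<^sup>+x. (\<Sum>j\<in>UNIV. ennreal (p (h t) j) * ennreal (q j (state A B K h x (Suc t)))) \<partial>D)"
      unfolding I_def by (simp add: nn_integral_sum nn_integral_cmult)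
    also have "\<dots> = (\<integral>\<^sup>+x. ennreal (mode_step p (\<lambda>i. A i - B i ** K i) q (h t) (state A B K h x t)) \<partial>D)"
      by (simp add: mode_step_def state_closed_loop ennreal_mult[symmetric] p_nonneg nonneg)
    finally show ?thesis .
  qed
  have "expected A B K (Suc t) q = (\<Sum>h\<in>?P. \<integral>\<^sup>+m. F m * indicator (path_event t h) m \<partial>M)"
    unfolding expected_def F_def[symmetric] by (intro nn_integral_paths) measurable
  also have "\<dots> = expected A B K t (mode_step p (\<lambda>i. A i - B i ** K i) q)"
    unfolding expected_paths[OF step] path integral ..
  finally show ?thesis .
qed

lemma state_form_measurable:
  assumes "\<And>i. psd_form (q i)"
  shows "(\<lambda>m. q (w t m) (state A B K (\<lambda>s. w s m) (x0 m) t)) \<in> borel_measurable M"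
  by (rule mode_function_measurable[OF psd_form_measurable[OF assms] state_measurable])

text \<open>Peeling off the first stage leaves a sum starting at \<open>Suc s\<close>, which is why
  the start \<open>s\<close> is general. \<open>expected_Suc\<close> then moves the value of that
  sum back to time \<open>s\<close>.\<close>

lemma sum_expected:
  assumes "\<And>i. psd_form (c i)"
  shows "(\<Sum>t<n. expected A B K (s + t) c)
    = expected A B K s (value_iter p (\<lambda>i. A i - B i ** K i) c n)"
proof (induction n arbitrary: s)
  case 0
  then show ?case by (simp add: expected_def)
next
  case (Suc n)
  let ?L = "\<lambda>i. A i - B i ** K i"
  let ?V = "value_iter p ?L c n"
  have V: "psd_form (?V i)" for i by (intro psd_form_value_iter assms)
  have S: "psd_form (mode_step p ?L ?V i)" for i by (intro psd_form_mode_step V)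
  have "(\<Sum>t<Suc n. expected A B K (s + t) c)
      = expected A B K s c + (\<Sum>t<n. expected A B K (Suc s + t) c)"
    by (subst sum.lessThan_Suc_shift) simp
  also have "\<dots> = expected A B K s c + expected A B K s (mode_step p ?L ?V)"
    by (simp only: Suc expected_Suc psd_form_measurable[OF V] psd_form_nonneg[OF V])
  also have "\<dots> = expected A B K s (value_iter p ?L c (Suc n))"
    unfolding expected_def value_iter.simps
    using psd_form_nonneg[OF assms] psd_form_nonneg[OF S] state_form_measurable[of c, OF assms] state_form_measurable[of "mode_step p ?L ?V", OF S]
    by (subst nn_integral_add[symmetric]) (auto simp: ennreal_plus)
  finally show ?case .
qed

end

section \<open>Bounds from the second moment\<close>

lemma outer_form: "y \<bullet> (outer x *v y) = (x \<bullet> y)\<^sup>2"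
proof -
  have "outer x *v y = (x \<bullet> y) *\<^sub>R x"
    by (simp add: outer_def matrix_vector_mult_def vec_eq_iff inner_vec_def sum_distrib_left algebra_simps)
  then show ?thesis by (simp add: power2_eq_square inner_commute)
qed

text \<open>The value of a form at \<open>y\<close> is a bounded linear functional of its matrix, so
  it commutes with the integral of \<open>outer\<close>.\<close>

lemma nn_integral_square_inner:
  fixes D :: "(real^'d) measure"
  assumes "integrable D outer"
  shows "(\<integral>\<^sup>+x. ennreal ((x \<bullet> y)\<^sup>2) \<partial>D) = ennreal (y \<bullet> (second_moment D *v y))"
proof -
  have "linear (\<lambda>G :: real^'d^'d. y \<bullet> (G *v y))"
    by (rule linearI)
      (simp_all add: matrix_vector_mult_add_rdistrib inner_add_right matrix_scaleR_vector_mult)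
  then have bl: "bounded_linear (\<lambda>G :: real^'d^'d. y \<bullet> (G *v y))"
    by (simp add: linear_conv_bounded_linear)
  have int: "integrable D (\<lambda>x. (x \<bullet> y)\<^sup>2)"
    using integrable_bounded_linear[OF bl assms] by (simp add: outer_form)
  have "(\<integral>x. (x \<bullet> y)\<^sup>2 \<partial>D) = y \<bullet> (second_moment D *v y)"
    using integral_bounded_linear[OF bl assms] by (simp add: outer_form second_moment_def)
  then show ?thesis using nn_integral_eq_integral[OF int] by simp
qed

text \<open>Cauchy-Schwarz bounds the form from below by the rank-one form \<open>(x \<bullet> (G *v v))\<^sup>2\<close>, whose
  integral is a value of the second moment.\<close>
lemma psd_form_le_integral:
  fixes D :: "(real^'d) measure"
  assumes int: "integrable D outer" and pd: "pos_def (second_moment D)" and sets: "sets D = sets borel"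
    and q: "psd_form q" and a: "(\<integral>\<^sup>+x. ennreal (q x) \<partial>D) \<le> ennreal a" "0 \<le> a"
  shows "sigma_min (second_moment D) * q v \<le> a * (norm v)\<^sup>2"
proof (cases "q v = 0")
  case True
  then show ?thesis using a by simp
next
  case False
  obtain G where G: "psd G" "q = (\<lambda>x. x \<bullet> (G *v x))" using q unfolding psd_form_def by blast
  define y where "y = G *v v"
  let ?s = "sigma_min (second_moment D)"
  have qv: "0 < q v" using False psd_form_nonneg[OF q, of v] by simp
  have [measurable]: "(\<lambda>x. ennreal (q x)) \<in> borel_measurable D"
    using psd_form_measurable[OF q] unfolding measurable_cong_sets[OF sets refl] by measurable
  have "ennreal (?s * (norm y)\<^sup>2) \<le> ennreal (y \<bullet> (second_moment D *v y))"
    by (intro ennreal_leI sigma_min_le_quadratic_form pd)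
  also have "\<dots> = (\<integral>\<^sup>+x. ennreal ((x \<bullet> y)\<^sup>2) \<partial>D)"
    by (rule nn_integral_square_inner[OF int, symmetric])
  also have "\<dots> \<le> (\<integral>\<^sup>+x. ennreal (q v) * ennreal (q x) \<partial>D)"
    using psd_cauchy_schwarz[OF G(1), of _ v] qv
    by (intro nn_integral_mono)
      (simp add: y_def G(2) ennreal_mult''[symmetric] psd_nonneg[OF G(1)] mult.commute ennreal_leI)
  also have "\<dots> = ennreal (q v) * (\<integral>\<^sup>+x. ennreal (q x) \<partial>D)" by (intro nn_integral_cmult) measurable
  also have "\<dots> \<le> ennreal (q v) * ennreal a" by (intro mult_left_mono a) auto
  finally have 1: "?s * (norm y)\<^sup>2 \<le> q v * a"
    using a qv by (simp add: ennreal_mult''[symmetric])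
  \<comment> \<open>As \<open>q v = v \<bullet> y\<close>, the ordinary Cauchy-Schwarz inequality
    converts the bound on \<open>y\<close> into one on \<open>v\<close>.\<close>
  have "(q v)\<^sup>2 \<le> (norm v)\<^sup>2 * (norm y)\<^sup>2"
    using Cauchy_Schwarz_ineq[of v y] by (simp add: G(2) y_def power2_norm_eq_inner)
  then have "?s * (q v)\<^sup>2 \<le> (norm v)\<^sup>2 * (?s * (norm y)\<^sup>2)"
    using mult_left_mono[of "(q v)\<^sup>2" "(norm v)\<^sup>2 * (norm y)\<^sup>2" ?s] sigma_min_pos[OF pd]
    by (simp add: mult.left_commute)
  also have "\<dots> \<le> (norm v)\<^sup>2 * (q v * a)" by (intro mult_left_mono 1) auto
  finally have "q v * (?s * q v) \<le> q v * (a * (norm v)\<^sup>2)" by (simp add: power2_eq_square algebra_simps)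
  then show ?thesis using qv by simp
qed

section \<open>Stage costs as quadratic forms\<close>

lemma stage_cost_eq:
  "stage_cost Q R K i x = x \<bullet> (Q i *v x) + (K i *v x) \<bullet> (R i *v (K i *v x))"
  using matrix_vector_mult_diff_distrib[of "R i" 0 "K i *v x"]
  by (simp add: stage_cost_def control_def)

lemma psd_form_stage_cost:
  assumes "\<And>i. pos_def (Q i)" "\<And>i. pos_def (R i)"
  shows "psd_form (stage_cost Q R K i)"
proof -
  have "psd_form (\<lambda>x. x \<bullet> (Q i *v x) + (K i *v x) \<bullet> (R i *v (K i *v x)))"
    by (intro psd_form_add psd_form_compose[of "\<lambda>y. y \<bullet> (R i *v y)"] psd_formI pos_def_imp_psd assms)
  then show ?thesis by (simp add: stage_cost_eq[abs_def])
qed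

lemma stage_cost_lower:
  assumes "\<And>i. pos_def (Q i)" "\<And>i. pos_def (R i)"
  shows "Lambda_min Q * (norm x)\<^sup>2 \<le> stage_cost Q R K i x"
  using Lambda_min_le_quadratic_form[of Q x i, OF assms(1)]
    psd_nonneg[OF pos_def_imp_psd[OF assms(2)[of i]], of "K i *v x"]
  by (simp add: stage_cost_eq)

lemma stage_cost_upper:
  fixes Q :: "'s::finite \<Rightarrow> real^'d^'d" and R :: "'s \<Rightarrow> real^'k^'k"
  shows "stage_cost Q R K i x \<le> (tuple_norm Q + tuple_norm R * (tuple_norm K)\<^sup>2) * (norm x)\<^sup>2"
proof -
  have "(K i *v x) \<bullet> (R i *v (K i *v x)) \<le> tuple_norm R * (norm (K i *v x))\<^sup>2"
    by (rule quadratic_form_le_tuple_norm)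
  also have "\<dots> \<le> tuple_norm R * (tuple_norm K * norm x)\<^sup>2"
    by (intro mult_left_mono power_mono norm_mult_le_tuple_norm tuple_norm_nonneg) auto
  finally show ?thesis
    using quadratic_form_le_tuple_norm[of x Q i]
    by (simp add: stage_cost_eq power_mult_distrib algebra_simps)
qed

lemma stage_cost_perturb:
  fixes R :: "'s::finite \<Rightarrow> real^'k^'k"
  assumes "\<And>i. pos_def (R i)"
  shows "\<bar>stage_cost Q R K' i x - stage_cost Q R K i x\<bar>
    \<le> tuple_norm R * (2 * tuple_norm K * tuple_norm (\<lambda>i. K' i - K i)
        + (tuple_norm (\<lambda>i. K' i - K i))\<^sup>2) * (norm x)\<^sup>2"
proof -
  define y z where "y = K i *v x" and "z = (K' i - K i) *v x"
  have y: "norm y \<le> tuple_norm K * norm x" unfolding y_def by (rule norm_mult_le_tuple_norm)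
  have z: "norm z \<le> tuple_norm (\<lambda>i. K' i - K i) * norm x"
    unfolding z_def by (rule norm_mult_le_tuple_norm)
  have "K' i *v x = y + z" by (simp add: y_def z_def matrix_vector_mult_diff_rdistrib)
  then have "\<bar>stage_cost Q R K' i x - stage_cost Q R K i x\<bar>
      = \<bar>(y + z) \<bullet> (R i *v (y + z)) - y \<bullet> (R i *v y)\<bar>"
    by (simp add: stage_cost_eq y_def)
  also have "\<dots> \<le> tuple_norm R * (2 * (norm y * norm z) + (norm z)\<^sup>2)"
    using psd_perturb[OF pos_def_imp_psd[OF assms[of i]] tuple_norm_nonneg[of R] quadratic_form_le_tuple_norm]
    by (simp add: mult.assoc)
  also have "\<dots> \<le> tuple_norm R * (2 * ((tuple_norm K * norm x) * (tuple_norm (\<lambda>i. K' i - K i) * norm x))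
      + (tuple_norm (\<lambda>i. K' i - K i) * norm x)\<^sup>2)"
    by (intro mult_left_mono add_mono mult_mono power_mono y z)
      (auto simp: tuple_norm_nonneg mult_nonneg_nonneg)
  finally show ?thesis by (simp add: power2_eq_square algebra_simps)
qed

section \<open>Perturbation of the cost\<close>

text \<open>The arguments stand for the number of modes, \<open>mu\<close>, the norms of
  \<open>A\<close>, \<open>B\<close>, \<open>Q\<close>, \<open>R\<close>, \<open>K\<close>, and the
  cost divided by \<open>Lambda_min Q\<close>. The factor
  \<open>(q + r * k\<^sup>2) * (c / m)\<close> bounds the value functions and
  \<open>a + b * k\<close> the closed loop. The terms with \<open>n * k\<close> stem from the
  squared policy distance, one factor of which the radius bounds by \<open>n * k\<close>.\<close>

definition lipschitz_const ::
  "real \<Rightarrow> real \<Rightarrow> real \<Rightarrow> real \<Rightarrow> real \<Rightarrow> real \<Rightarrow> real \<Rightarrow> real \<Rightarrow> real" where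
  "lipschitz_const n m a b q r k c =
     2 * c * (r * (2 * k + n * k)
       + (q + r * k\<^sup>2) * (c / m) * (2 * (a + b * k) * b + b\<^sup>2 * (n * k)))"

locale mjls_pos = mjls M w x0 D \<pi> p
  for M :: "'m measure" and w :: "nat \<Rightarrow> 'm \<Rightarrow> 's::finite" and x0 :: "'m \<Rightarrow> real^'d"
    and D :: "(real^'d) measure" and \<pi> :: "'s \<Rightarrow> real" and p :: "'s \<Rightarrow> 's \<Rightarrow> real" +
  assumes int_D: "integrable D outer"
    and pd_D: "pos_def (second_moment D)"
begin

lemma min_init_pos: "0 < Min (range \<pi>)"
  using init_pos by (subst Min_gr_iff) auto

lemma mu_pos: "0 < mu \<pi> D"
  unfolding mu_def by (intro mult_pos_pos min_init_pos sigma_min_pos pd_D)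

definition initial :: "('s \<Rightarrow> real^'d \<Rightarrow> real) \<Rightarrow> ennreal" where
  "initial q = (\<integral>\<^sup>+m. ennreal (q (w 0 m) (x0 m)) \<partial>M)"

lemma initial_mono: "(\<And>i x. q i x \<le> r i x) \<Longrightarrow> initial q \<le> initial r"
  unfolding initial_def by (intro nn_integral_mono ennreal_leI)

lemma initial_measurable:
  assumes "\<And>i. psd_form (q i)"
  shows "(\<lambda>m. ennreal (q (w 0 m) (x0 m))) \<in> borel_measurable M"
  by (rule measurable_compose[OF mode_function_measurable[OF psd_form_measurable[OF assms] x0_measurable]
        measurable_ennreal])

lemma initial_scale:
  assumes "\<And>i. psd_form (q i)" "0 \<le> a"
  shows "initial (\<lambda>i x. a * q i x) = ennreal a * initial q"
  unfolding initial_def using assms initial_measurable[OF assms(1)]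
  by (simp add: ennreal_mult psd_form_nonneg nn_integral_cmult)

lemma initial_add:
  assumes "\<And>i. psd_form (q i)" "\<And>i. psd_form (r i)"
  shows "initial (\<lambda>i x. q i x + r i x) = initial q + initial r"
  unfolding initial_def using assms initial_measurable[OF assms(1)] initial_measurable[OF assms(2)]
  by (simp add: ennreal_plus psd_form_nonneg nn_integral_add)

text \<open>Discarding all initial modes but \<open>i\<close> only lowers the expectation, and on
  the remaining event independence factors out \<open>\<pi> i\<close>.\<close>

lemma initial_mode_le:
  assumes q: "\<And>i. psd_form (q i)"
  shows "ennreal (\<pi> i) * (\<integral>\<^sup>+x. ennreal (q i x) \<partial>D) \<le> initial q"
proof -
  have ev: "{m \<in> space M. w 0 m = i} \<in> mode_events"
    using mode_event[of "{0}" "\<lambda>_. i"] by simp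
  have [measurable]: "q i \<in> borel_measurable borel" by (intro psd_form_measurable q)
  have "ennreal (\<pi> i) * (\<integral>\<^sup>+x. ennreal (q i x) \<partial>D)
      = (\<integral>\<^sup>+m. ennreal (q i (x0 m)) * indicator {m \<in> space M. w 0 m = i} m \<partial>M)"
    by (subst nn_integral_indep[OF ev]) (auto simp: emeasure_eq_measure prob_init)
  also have "\<dots> \<le> initial q"
    unfolding initial_def by (intro nn_integral_mono) (auto simp: indicator_def)
  finally show ?thesis .
qed

text \<open>A series of nonnegative terms is the supremum of its partial sums, which
  \<open>sum_expected\<close> identifies as finite-horizon values. Bounds uniform in
  \<open>n\<close> thus pass to the cost, even before it is known to be finite.\<close>

lemma cost_eq_SUP:
  assumes "\<And>i. pos_def (Q i)" "\<And>i. pos_def (R i)"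
  shows "cost M w x0 A B Q R K
    = (SUP n. initial (value_iter p (\<lambda>i. A i - B i ** K i) (stage_cost Q R K) n))"
proof -
  note psd = psd_form_stage_cost[of Q R K, OF assms]
  have "cost M w x0 A B Q R K = (\<Sum>t. expected A B K t (stage_cost Q R K))"
    unfolding cost_def expected_def
    by (intro nn_integral_suminf measurable_compose[OF state_form_measurable[OF psd] measurable_ennreal])
  also have "\<dots> = (SUP n. \<Sum>t<n. expected A B K t (stage_cost Q R K))"
    by (rule suminf_eq_SUP)
  also have "\<dots> = (SUP n. initial (value_iter p (\<lambda>i. A i - B i ** K i) (stage_cost Q R K) n))"
    using sum_expected[where c = "stage_cost Q R K" and s = 0 and A = A and B = B and K = K, OF psd] by (simp add: expected_def initial_def)
  finally show ?thesis .
qed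

lemma cost_perturb:
  fixes A :: "'s \<Rightarrow> real^'d^'d" and B :: "'s \<Rightarrow> real^'k^'d"
    and K K' :: "'s \<Rightarrow> real^'d^'k"
  assumes pdQ: "\<And>i. pos_def (Q i)" and pdR: "\<And>i. pos_def (R i)"
    and finite_cost: "cost M w x0 A B Q R K = ennreal C" "0 \<le> C"
    and rad: "ereal (tuple_norm (\<lambda>i. K' i - K i)) \<le> radius \<pi> D A B Q K C"
  defines "f \<equiv> lipschitz_const (real CARD('s)) (mu \<pi> D) (tuple_norm A) (tuple_norm B)
    (tuple_norm Q) (tuple_norm R) (tuple_norm K) (C / Lambda_min Q)"
  shows "cost M w x0 A B Q R K' < \<infinity>"
    and "\<bar>enn2real (cost M w x0 A B Q R K') - C\<bar> \<le> f * tuple_norm (\<lambda>i. K i - K' i)"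
proof -
  define \<Lambda> where "\<Lambda> = Lambda_min Q"
  define \<mu> where "\<mu> = mu \<pi> D"
  define \<delta> where "\<delta> = tuple_norm (\<lambda>i. K' i - K i)"
  define L where "L i = A i - B i ** K i" for i
  define L' where "L' i = A i - B i ** K' i" for i
  define c where "c = stage_cost Q R K"
  define c' where "c' = stage_cost Q R K'"
  define \<kappa> where "\<kappa> = C / (\<Lambda> * \<mu>)"
  let ?V = "value_iter p L c" and ?V' = "value_iter p L' c'"
  let ?U = "value_iter p L sqnorm_cost" and ?U' = "value_iter p L' sqnorm_cost"
  have \<Lambda>: "0 < \<Lambda>" unfolding \<Lambda>_def by (rule Lambda_min_pos[OF pdQ])
  have \<mu>: "0 < \<mu>" unfolding \<mu>_def by (rule mu_pos)
  have \<delta>: "0 \<le> \<delta>" unfolding \<delta>_def by (rule tuple_norm_nonneg)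
  have \<kappa>0: "0 \<le> \<kappa>" using \<Lambda> \<mu> finite_cost by (simp add: \<kappa>_def)
  have psdc: "psd_form (c i)" "psd_form (c' i)" for i
    unfolding c_def c'_def by (intro psd_form_stage_cost pdQ pdR)+
  have psdV: "psd_form (?V n i)" "psd_form (?V' n i)" for n i
    by (intro psd_form_value_iter psdc)+
  have psdU: "psd_form (?U n i)" for n i
    by (intro psd_form_value_iter) (simp add: sqnorm_cost_def[abs_def] psd_form_norm)
  have costK: "cost M w x0 A B Q R K = (SUP n. initial (?V n))"
    unfolding L_def[abs_def] c_def by (rule cost_eq_SUP[OF pdQ pdR])
  have costK': "cost M w x0 A B Q R K' = (SUP n. initial (?V' n))"
    unfolding L'_def[abs_def] c'_def by (rule cost_eq_SUP[OF pdQ pdR])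
  have V_le: "initial (?V n) \<le> ennreal C" for n
    unfolding finite_cost(1)[symmetric] costK by (intro SUP_upper) auto
  have V'_le: "initial (?V' n) \<le> cost M w x0 A B Q R K'" for n
    unfolding costK' by (intro SUP_upper) auto
  have UV: "?U n i x \<le> 1 / \<Lambda> * ?V n i x" for n i x
    using stage_cost_lower[of Q R, OF pdQ pdR] \<Lambda> unfolding c_def \<Lambda>_def
    by (intro value_iter_mono) (simp add: sqnorm_cost_def field_simps)
  have VU: "?V n i x \<le> (tuple_norm Q + tuple_norm R * (tuple_norm K)\<^sup>2) * ?U n i x" for n i x
    unfolding c_def by (intro value_iter_mono) (simp add: sqnorm_cost_def stage_cost_upper)
  have U_bound: "?U n i x \<le> \<kappa> * (norm x)\<^sup>2" for n i x
  proof -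
    define m where "m = Min (range \<pi>)"
    have m: "0 < m" unfolding m_def by (rule min_init_pos)
    let ?I = "\<integral>\<^sup>+x. ennreal (?U n i x) \<partial>D"
    have "ennreal m * ?I \<le> ennreal (\<pi> i) * ?I" unfolding m_def
      by (intro mult_right_mono ennreal_leI Min_le) auto
    also have "\<dots> \<le> initial (?U n)" by (intro initial_mode_le psdU)
    also have "\<dots> \<le> initial (\<lambda>i x. 1 / \<Lambda> * ?V n i x)" by (intro initial_mono UV)
    also have "\<dots> = ennreal (1 / \<Lambda>) * initial (?V n)"
      using \<Lambda> by (intro initial_scale psdV) auto
    also have "\<dots> \<le> ennreal (1 / \<Lambda>) * ennreal C" by (intro mult_left_mono V_le) auto
    also have "\<dots> = ennreal (C / \<Lambda>)"
      using \<Lambda> finite_cost(2) by (simp add: ennreal_mult[symmetric])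
    finally have le: "ennreal m * ?I \<le> ennreal (C / \<Lambda>)" .
    \<comment> \<open>\<open>m\<close> is positive and finite, so multiplying by
      \<open>1 / m\<close> removes it in the extended reals.\<close>
    have "?I = ennreal (1 / m * m) * ?I" using m by simp
    also have "\<dots> = ennreal (1 / m) * (ennreal m * ?I)"
      using m by (subst ennreal_mult) (auto simp: mult.assoc)
    also have "\<dots> \<le> ennreal (1 / m) * ennreal (C / \<Lambda>)" by (intro mult_left_mono le) auto
    also have "\<dots> = ennreal (C / \<Lambda> / m)"
      using m \<Lambda> finite_cost(2) by (subst ennreal_mult[symmetric]) auto
    finally have "?I \<le> ennreal (C / \<Lambda> / m)" .
    then have "sigma_min (second_moment D) * ?U n i x \<le> C / \<Lambda> / m * (norm x)\<^sup>2"
      using m \<Lambda> finite_cost(2)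
      by (intro psd_form_le_integral[OF int_D pd_D sets_D psdU]) auto
    then show ?thesis
      using sigma_min_pos[OF pd_D] m \<Lambda>
      by (simp add: \<kappa>_def \<mu>_def mu_def m_def[symmetric] field_simps)
  qed
  \<comment> \<open>The iteration starts from 0, so at horizon 1 \<open>?U\<close> is exactly
    \<open>(norm x)\<^sup>2\<close>; a unit vector then gives the claim. It makes \<open>C\<close>
    positive and later helps to bound the loop perturbation.\<close>
  have \<kappa>1: "1 \<le> \<kappa>"
    using U_bound[of 1 undefined "axis undefined 1"]
    by (simp add: mode_step_def sqnorm_cost_def)
  have Lb: "norm (L' i *v x - L i *v x) \<le> mat_norm (B i) * \<delta> * norm x" for i x
  proof -
    have "L' i *v x - L i *v x = B i *v (K i *v x) - B i *v (K' i *v x)"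
      by (simp add: L_def L'_def matrix_vector_mult_diff_rdistrib matrix_vector_mul_assoc)
    also have "\<dots> = - (B i *v ((K' i - K i) *v x))"
      by (simp add: matrix_vector_mult_diff_rdistrib matrix_vector_mult_diff_distrib)
    finally have "norm (L' i *v x - L i *v x) \<le> mat_norm (B i) * norm ((K' i - K i) *v x)"
      by (simp add: norm_mult_le_mat_norm)
    also have "\<dots> \<le> mat_norm (B i) * (\<delta> * norm x)"
      unfolding \<delta>_def by (intro mult_left_mono norm_mult_le_tuple_norm[of "\<lambda>i. K' i - K i"] mat_norm_nonneg)
    finally show ?thesis by simp
  qed
  define S where "S = (\<Sum>i\<in>UNIV. mat_norm (B i) * (mat_norm (L i) + 1))"
  have S_le: "mat_norm (B i) * (mat_norm (L i) + 1) \<le> S" for i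
    unfolding S_def by (intro member_le_sum) (auto simp: mat_norm_nonneg)
  have S0: "0 \<le> S" unfolding S_def by (intro sum_nonneg) (simp add: mat_norm_nonneg)
  have Cpos: "0 < C" using \<kappa>1 finite_cost(2) by (cases "C = 0") (auto simp: \<kappa>_def)
  \<comment> \<open>The first part of the radius condition with its denominator cleared. For
    \<open>S = 0\<close> the quotient is infinite, but then the left-hand side is 0.\<close>
  have small: "4 * C * S * \<delta> \<le> \<Lambda> * \<mu>"
  proof (cases "S = 0")
    case False
    have "ereal \<delta> \<le> ereal (\<Lambda> * \<mu>) / ereal (4 * C * S)"
      using rad by (simp add: radius_def \<delta>_def \<Lambda>_def \<mu>_def S_def L_def)
    then show ?thesis using False S0 Cpos by (simp add: field_simps)
  qed (use \<Lambda> \<mu> in simp)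
  \<comment> \<open>The second part of the radius condition, restated with the tuple norm because
    the final constant may depend on \<open>K\<close> only through it.\<close>
  have \<delta>K: "\<delta> \<le> real CARD('s) * tuple_norm K"
  proof -
    have "\<delta> \<le> (\<Sum>i\<in>UNIV. mat_norm (K i))" using rad by (simp add: radius_def \<delta>_def)
    also have "\<dots> \<le> (\<Sum>i\<in>(UNIV::'s set). tuple_norm K)" by (intro sum_mono mat_norm_le_tuple_norm)
    finally show ?thesis by simp
  qed
  have small_mode: "\<kappa> * (2 * mat_norm (L i) * (mat_norm (B i) * \<delta>) + (mat_norm (B i) * \<delta>)\<^sup>2) \<le> 1 / 2" for i
  proof -
    define b l where "b = mat_norm (B i) * \<delta>" and "l = mat_norm (L i)"
    have b: "0 \<le> b" and l: "0 \<le> l" using \<delta> by (auto simp: b_def l_def mat_norm_nonneg)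
    have "b * (l + 1) \<le> S * \<delta>"
      using mult_right_mono[OF S_le[of i] \<delta>] by (simp add: b_def l_def algebra_simps)
    then have "4 * C * (b * (l + 1)) \<le> 4 * C * (S * \<delta>)" using Cpos by simp
    then have "4 * C * (b * (l + 1)) \<le> \<Lambda> * \<mu>" using small by (simp add: mult.assoc)
    then have k: "\<kappa> * (b * (l + 1)) \<le> 1 / 4" using \<Lambda> \<mu> by (simp add: \<kappa>_def field_simps)
    \<comment> \<open>\<open>b\<close> is at most \<open>1 / 4\<close>, in particular at most 2, so
      \<open>b\<^sup>2 \<le> 2 * b\<close>: the summand 1 beside the loop norm in the radius absorbs
      the quadratic term. The factor 4 in the radius leaves
      \<open>2 * (1 / 4) = 1 / 2\<close>.\<close>
    have "b \<le> b * (l + 1)" using b l by (simp add: algebra_simps)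
    also have "\<dots> \<le> \<kappa> * (b * (l + 1))" using mult_right_mono[OF \<kappa>1, of "b * (l + 1)"] b l by simp
    finally have "b \<le> 2" using k by simp
    then have "b\<^sup>2 \<le> 2 * b" using b by (simp add: power2_eq_square mult_right_mono)
    then have "\<kappa> * (2 * l * b + b\<^sup>2) \<le> \<kappa> * (2 * (b * (l + 1)))"
      using \<kappa>0 by (intro mult_left_mono) (auto simp: algebra_simps)
    then show ?thesis using k by (simp add: b_def l_def)
  qed
  have U': "?U' n i x \<le> 2 * ?U n i x" for n i x
    by (rule value_iter_sqnorm_perturb[where l = "\<lambda>i. mat_norm (L i)" and b = "\<lambda>i. mat_norm (B i) * \<delta>",
          OF \<kappa>0 U_bound norm_mult_le_mat_norm mat_norm_nonneg Lb _ small_mode])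
      (simp add: mat_norm_nonneg \<delta>)
  \<comment> \<open>So far the bounds were taken mode by mode, as in the radius. From here on they
    are uniform and use only tuple norms, as the Lipschitz constant requires.\<close>
  define l where "l = tuple_norm A + tuple_norm B * tuple_norm K"
  define v where "v = (tuple_norm Q + tuple_norm R * (tuple_norm K)\<^sup>2) * \<kappa>"
  define h where "h = tuple_norm R * (2 * tuple_norm K * \<delta> + \<delta>\<^sup>2)"
  define b where "b = tuple_norm B * \<delta>"
  define H where "H = h + v * (2 * l * b + b\<^sup>2)"
  have nn: "0 \<le> tuple_norm A" "0 \<le> tuple_norm B" "0 \<le> tuple_norm Q" "0 \<le> tuple_norm R" "0 \<le> tuple_norm K"
    by (rule tuple_norm_nonneg)+
  have pos: "0 \<le> l" "0 \<le> v" "0 \<le> h" "0 \<le> b"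
    using nn \<delta> \<kappa>0 by (auto simp: l_def v_def h_def b_def)
  have H0: "0 \<le> H" using pos by (simp add: H_def)
  have V_bound: "?V n i x \<le> v * (norm x)\<^sup>2" for n i x
  proof -
    have "(tuple_norm Q + tuple_norm R * (tuple_norm K)\<^sup>2) * ?U n i x
        \<le> (tuple_norm Q + tuple_norm R * (tuple_norm K)\<^sup>2) * (\<kappa> * (norm x)\<^sup>2)"
      using nn by (intro mult_left_mono U_bound) auto
    then show ?thesis using VU[of n i x] by (simp add: v_def mult.assoc)
  qed
  have Ll: "norm (L i *v x) \<le> l * norm x" for i x
  proof -
    have "norm (L i *v x) \<le> norm (A i *v x) + norm (B i *v (K i *v x))"
      by (simp add: L_def matrix_vector_mult_diff_rdistrib matrix_vector_mul_assoc norm_triangle_ineq4)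
    also have "norm (B i *v (K i *v x)) \<le> tuple_norm B * norm (K i *v x)"
      by (rule norm_mult_le_tuple_norm)
    also have "\<dots> \<le> tuple_norm B * (tuple_norm K * norm x)"
      by (intro mult_left_mono norm_mult_le_tuple_norm nn)
    finally show ?thesis using norm_mult_le_tuple_norm[of A i x] by (simp add: l_def algebra_simps)
  qed
  have Lb': "norm (L' i *v x - L i *v x) \<le> b * norm x" for i x
    using Lb[of i x] mult_right_mono[OF mult_right_mono[OF mat_norm_le_tuple_norm[of B i] \<delta>], of "norm x"]
    by (simp add: b_def)
  have cc: "\<bar>c' i x - c i x\<bar> \<le> h * (norm x)\<^sup>2" for i x
    unfolding c_def c'_def h_def \<delta>_def by (rule stage_cost_perturb[OF pdR])
  \<comment> \<open>Expressed through \<open>?V\<close>, the error becomes relative: its expectation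
    is at most \<open>g * C\<close> at every horizon.\<close>
  define g where "g = 2 * H / \<Lambda>"
  have g0: "0 \<le> g" using H0 \<Lambda> by (simp add: g_def)
  have diff: "\<bar>?V' n i x - ?V n i x\<bar> \<le> g * ?V n i x" for n i x
  proof -
    have "\<bar>?V' n i x - ?V n i x\<bar> \<le> H * ?U' n i x"
      unfolding H_def by (rule value_iter_perturb[OF psdc(1) pos(2) V_bound cc Ll pos(1) Lb' pos(4)])
    also have "\<dots> \<le> H * (2 * (1 / \<Lambda> * ?V n i x))"
      using U'[of n i x] UV[of n i x] by (intro mult_left_mono H0) linarith
    finally show ?thesis by (simp add: g_def mult.assoc mult.left_commute)
  qed
  have gV: "initial (\<lambda>i x. g * ?V n i x) \<le> ennreal (g * C)" for n
    using V_le[of n] g0 finite_cost(2)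
    by (simp add: initial_scale psdV ennreal_mult mult_left_mono)
  have psdgV: "psd_form (\<lambda>x. g * ?V n i x)" for n i by (intro psd_form_scale psdV g0)
  have "initial (?V' n) \<le> ennreal (C + g * C)" for n
  proof -
    have "initial (?V' n) \<le> initial (\<lambda>i x. ?V n i x + g * ?V n i x)"
      using diff[of n] by (intro initial_mono) (simp add: abs_le_iff algebra_simps)
    also have "\<dots> = initial (?V n) + initial (\<lambda>i x. g * ?V n i x)"
      by (intro initial_add psdV psdgV)
    also have "\<dots> \<le> ennreal C + ennreal (g * C)" by (intro add_mono V_le gV)
    finally show ?thesis using g0 finite_cost(2) by (simp add: ennreal_plus)
  qed
  then have up: "cost M w x0 A B Q R K' \<le> ennreal (C + g * C)"
    unfolding costK' by (intro SUP_least)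
  then show fin: "cost M w x0 A B Q R K' < \<infinity>"
    by (metis ennreal_less_top infinity_ennreal_def le_less_trans)
  then obtain C' where C': "cost M w x0 A B Q R K' = ennreal C'" "0 \<le> C'"
    by (cases "cost M w x0 A B Q R K'") auto
  \<comment> \<open>The error is again measured by \<open>?V\<close>, not by \<open>?V'\<close>, so
    the converse estimate has the same \<open>g * C\<close>.\<close>
  have "initial (?V n) \<le> ennreal (C' + g * C)" for n
  proof -
    have "initial (?V n) \<le> initial (\<lambda>i x. ?V' n i x + g * ?V n i x)"
      using diff[of n] by (intro initial_mono) (simp add: abs_le_iff algebra_simps)
    also have "\<dots> = initial (?V' n) + initial (\<lambda>i x. g * ?V n i x)"
      by (intro initial_add psdV psdgV)
    also have "\<dots> \<le> ennreal C' + ennreal (g * C)"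
      unfolding C'(1)[symmetric] by (intro add_mono V'_le gV)
    finally show ?thesis using g0 finite_cost(2) C'(2) by (simp add: ennreal_plus)
  qed
  then have "cost M w x0 A B Q R K \<le> ennreal (C' + g * C)"
    unfolding costK by (intro SUP_least)
  then have low: "C \<le> C' + g * C" using g0 finite_cost C'(2) by (simp del: ennreal_plus)
  have up': "C' \<le> C + g * C" using up g0 finite_cost C' by (simp del: ennreal_plus)
  \<comment> \<open>\<open>H\<close> contains \<delta> to first and second order. Replacing one
    factor of each square by the bound \<open>\<delta>K\<close> leaves \<delta> as a common
    factor.\<close>
  have "H \<le> (tuple_norm R * (2 * tuple_norm K + real CARD('s) * tuple_norm K)
      + v * (2 * l * tuple_norm B + (tuple_norm B)\<^sup>2 * (real CARD('s) * tuple_norm K))) * \<delta>"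
  proof -
    have dd: "\<delta>\<^sup>2 \<le> (real CARD('s) * tuple_norm K) * \<delta>"
      unfolding power2_eq_square by (intro mult_right_mono \<delta>K \<delta>)
    have "h \<le> tuple_norm R * (2 * tuple_norm K * \<delta> + (real CARD('s) * tuple_norm K) * \<delta>)"
      unfolding h_def by (intro mult_left_mono add_left_mono dd nn)
    moreover have "v * (2 * l * b + b\<^sup>2) \<le> v * (2 * l * b + (tuple_norm B)\<^sup>2 * ((real CARD('s) * tuple_norm K) * \<delta>))"
      unfolding b_def power_mult_distrib by (intro mult_left_mono add_left_mono dd pos) auto
    ultimately show ?thesis by (simp add: H_def b_def algebra_simps)
  qed
  then have "2 * (C / \<Lambda>) * H \<le> 2 * (C / \<Lambda>) * ((tuple_norm R * (2 * tuple_norm K + real CARD('s) * tuple_norm K)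
      + v * (2 * l * tuple_norm B + (tuple_norm B)\<^sup>2 * (real CARD('s) * tuple_norm K))) * \<delta>)"
    using \<Lambda> finite_cost(2) by (intro mult_left_mono) auto
  also have "\<dots> = f * \<delta>"
    by (simp add: f_def lipschitz_const_def v_def l_def \<kappa>_def \<Lambda>_def[symmetric] \<mu>_def[symmetric] mult.assoc)
  also have "2 * (C / \<Lambda>) * H = g * C" by (simp add: g_def)
  finally show "\<bar>enn2real (cost M w x0 A B Q R K') - C\<bar> \<le> f * tuple_norm (\<lambda>i. K i - K' i)"
    using low up' C' tuple_norm_minus_commute[of K K'] by (simp add: \<delta>_def abs_le_iff)
qed

end

text \<open>\<open>enn2real\<close> sends an infinite cost to 0, so finiteness of
  \<open>C K'\<close> is part of the claim: it makes the difference of costs the intended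
  one.\<close>

theorem lemma3:
  fixes M :: "'m measure"
    and w :: "nat \<Rightarrow> 'm \<Rightarrow> 's::finite"
    and x0 :: "'m \<Rightarrow> real^'d"
    and D :: "(real^'d) measure"
    and \<pi> :: "'s \<Rightarrow> real"
    and p :: "'s \<Rightarrow> 's \<Rightarrow> real"
  assumes "prob_space M"
    and "markov_chain M w \<pi> p"
    and "x0 \<in> borel_measurable M"
    and "distr M borel x0 = D"
    and "prob_space.indep_set M
           (sets (vimage_algebra (space M) x0 borel))
           (sets (vimage_algebra (space M) (\<lambda>m t. w t m) (\<Pi>\<^sub>M t\<in>UNIV. count_space UNIV)))"
    and "\<And>i. \<pi> i > 0"
    and "integrable D outer"
    and "pos_def (second_moment D)"
  shows "\<exists>f :: real \<Rightarrow> real \<Rightarrow> real \<Rightarrow> real \<Rightarrow> real \<Rightarrow> real \<Rightarrow> real.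
    \<forall>(A :: 's \<Rightarrow> real^'d^'d) (B :: 's \<Rightarrow> real^'k^'d) (Q :: 's \<Rightarrow> real^'d^'d) (R :: 's \<Rightarrow> real^'k^'k).
      (\<forall>i. pos_def (Q i)) \<longrightarrow> (\<forall>i. pos_def (R i)) \<longrightarrow> ms_stabilizable M w A B \<longrightarrow>
      (let C = cost M w x0 A B Q R in
       \<forall>K K'. C K < \<infinity> \<longrightarrow>
         ereal (tuple_norm (\<lambda>i. K' i - K i)) \<le> radius \<pi> D A B Q K (enn2real (C K)) \<longrightarrow>
         C K' < \<infinity> \<and>
         \<bar>enn2real (C K') - enn2real (C K)\<bar>
           \<le> f (tuple_norm A) (tuple_norm B) (tuple_norm Q) (tuple_norm R) (tuple_norm K)
                (enn2real (C K) / Lambda_min Q)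
             * tuple_norm (\<lambda>i. K i - K' i))"
proof -
  interpret prob_space M by fact
  interpret mjls_pos M w x0 D \<pi> p
    using assms by unfold_locales
  \<comment> \<open>The number of modes and \<open>mu \<pi> D\<close> depend only on the chain and
    on \<open>D\<close>, which are fixed before the function is chosen, so they may enter it as
    constants.\<close>
  let ?f = "lipschitz_const (real CARD('s)) (mu \<pi> D)"
  show ?thesis
  proof (intro exI[of _ ?f] allI impI, unfold Let_def, intro allI impI)
    fix A :: "'s \<Rightarrow> real^'d^'d" and B :: "'s \<Rightarrow> real^'k^'d" and Q R K K'
    assume Q: "\<forall>i. pos_def (Q i :: real^'d^'d)" and R: "\<forall>i. pos_def (R i :: real^'k^'k)"
      and fin: "cost M w x0 A B Q R K < \<infinity>"
      and rad: "ereal (tuple_norm (\<lambda>i. K' i - K i)) \<le> radius \<pi> D A B Q K (enn2real (cost M w x0 A B Q R K))"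
    have "cost M w x0 A B Q R K = ennreal (enn2real (cost M w x0 A B Q R K))"
      using fin by (simp add: ennreal_enn2real)
    from cost_perturb[OF Q[rule_format] R[rule_format] this enn2real_nonneg rad]
    show "cost M w x0 A B Q R K' < \<infinity> \<and>
         \<bar>enn2real (cost M w x0 A B Q R K') - enn2real (cost M w x0 A B Q R K)\<bar>
           \<le> ?f (tuple_norm A) (tuple_norm B) (tuple_norm Q) (tuple_norm R) (tuple_norm K)
                (enn2real (cost M w x0 A B Q R K) / Lambda_min Q)
             * tuple_norm (\<lambda>i. K i - K' i)" by blast
  qed
qed

end
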